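(* There exist universal constants $c_3,c_4>0$ such that the following holds. Let $\alpha,\beta>0$. There exists an integer $N_{\alpha,\beta}>0$ such that for all $d>N_{\alpha,\beta}$, all $L,m>0$ with $3\le \kappa:=L/m\le\alpha d^\beta$, all $M\ge 12$ and all $\epsilon\in(0,1)$, $$\mathfrak T(d,L,m,\epsilon,M)\ge\frac{c_3\,\kappa\sqrt d}{\max\{\log\kappa,\log d\}^3}\log\Big(\frac{c_4}{\epsilon}\Big).$$
   Context: Let $\mathcal A_{d,L,m}$ be the set of probability densities on $\mathbb R^d$ of the form $\pi\propto e^{-f}$ with $f$ twice differentiable, $L$-smooth (i.e. $f(y)\le f(x)+\nabla f(x)^\top(y-x)+\frac L2\|y-x\|_2^2$ for all $x,y$) and $m$-strongly convex (i.e. $f(y)\ge f(x)+\nabla f(x)^\top(y-x)+\frac m2\|y-x\|_2^2$ for all $x,y$). MALA with step size $h>0$ targeting $\pi\propto e^{-f}$: from the current state $x$, draw $y\sim\mathcal N(x-h\nabla f(x),2hI_d)$ and move to $y$ with probability $\min\{1,\frac{\pi(y)Q(y,x)}{\pi(x)Q(x,y)}\}$, where $Q(x,\cdot)$ is the density of $\mathcal N(x-h\nabla f(x),2hI_d)$; otherwise stay at $x$. $\mu_n$ is the law after $n$ steps from initial law $\mu_0$. $\mu_0$ is $M$-warm if $\mu_0(S)\le M\pi(S)$ for all Borel $S$. $\tau_{TV}(\epsilon,\mu_0)=\inf\{n:\sup_S|\mu_n(S)-\pi(S)|\le\epsilon\}$ (for the MALA chain with step size $h$ and target $\pi$). The minimax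 mixing time is $$\mathfrak T(d,L,m,\epsilon,M)=\min_{h>0}\ \max_{\pi\in\mathcal A_{d,L,m}}\ \max_{\mu_0\ M\text{-warm}}\ \tau_{TV}(\epsilon,\mu_0).$$ *)

theory Defs
  imports "HOL-Probability.Probability"
begin

definition Rd :: "nat \<Rightarrow> (nat \<Rightarrow> real) set" where
  "Rd d = PiE {..<d} (\<lambda>_. UNIV)"

definition lebd :: "nat \<Rightarrow> (nat \<Rightarrow> real) measure" where
  "lebd d = PiM {..<d} (\<lambda>_. lborel)"

definition vadd_d :: "nat \<Rightarrow> (nat \<Rightarrow> real) \<Rightarrow> (nat \<Rightarrow> real) \<Rightarrow> (nat \<Rightarrow> real)" where
  "vadd_d d x y = restrict (\<lambda>i. x i + y i) {..<d}"

definition vsub_d :: "nat \<Rightarrow> (nat \<Rightarrow> real) \<Rightarrow> (nat \<Rightarrow> real) \<Rightarrow> (nat \<Rightarrow> real)" where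
  "vsub_d d x y = restrict (\<lambda>i. x i - y i) {..<d}"

definition inner_d :: "nat \<Rightarrow> (nat \<Rightarrow> real) \<Rightarrow> (nat \<Rightarrow> real) \<Rightarrow> real" where
  "inner_d d x y = (\<Sum>i<d. x i * y i)"

definition norm_d :: "nat \<Rightarrow> (nat \<Rightarrow> real) \<Rightarrow> real" where
  "norm_d d x = sqrt (inner_d d x x)"

definition has_grad_d :: "nat \<Rightarrow> ((nat \<Rightarrow> real) \<Rightarrow> real) \<Rightarrow> (nat \<Rightarrow> real) \<Rightarrow> (nat \<Rightarrow> real) \<Rightarrow> bool" where
  "has_grad_d d f g x \<longleftrightarrow> g \<in> Rd d \<and>
     (\<forall>e>0. \<exists>\<delta>>0. \<forall>h\<in>Rd d. norm_d d h < \<delta> \<longrightarrow>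
        \<bar>f (vadd_d d x h) - f x - inner_d d g h\<bar> \<le> e * norm_d d h)"

definition has_jac_d :: "nat \<Rightarrow> ((nat \<Rightarrow> real) \<Rightarrow> (nat \<Rightarrow> real)) \<Rightarrow> (nat \<Rightarrow> nat \<Rightarrow> real) \<Rightarrow> (nat \<Rightarrow> real) \<Rightarrow> bool" where
  "has_jac_d d G H x \<longleftrightarrow>
     (\<forall>e>0. \<exists>\<delta>>0. \<forall>h\<in>Rd d. norm_d d h < \<delta> \<longrightarrow>
        norm_d d (\<lambda>i. G (vadd_d d x h) i - G x i - (\<Sum>j<d. H i j * h j)) \<le> e * norm_d d h)"

definition twice_diff_d :: "nat \<Rightarrow> ((nat \<Rightarrow> real) \<Rightarrow> real) \<Rightarrow> bool" where
  "twice_diff_d d f \<longleftrightarrow> (\<exists>G. (\<forall>x\<in>Rd d. has_grad_d d f (G x) x) \<and> (\<forall>x\<in>Rd d. \<exists>H. has_jac_d d G H x))"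

definition grad_d :: "nat \<Rightarrow> ((nat \<Rightarrow> real) \<Rightarrow> real) \<Rightarrow> (nat \<Rightarrow> real) \<Rightarrow> (nat \<Rightarrow> real)" where
  "grad_d d f x = (SOME g. has_grad_d d f g x)"

definition in_class :: "nat \<Rightarrow> real \<Rightarrow> real \<Rightarrow> ((nat \<Rightarrow> real) \<Rightarrow> real) \<Rightarrow> bool" where
  "in_class d L m f \<longleftrightarrow> twice_diff_d d f \<and>
     (\<forall>x\<in>Rd d. \<forall>y\<in>Rd d. f y \<le> f x + inner_d d (grad_d d f x) (vsub_d d y x) + L / 2 * (norm_d d (vsub_d d y x))\<^sup>2) \<and>
     (\<forall>x\<in>Rd d. \<forall>y\<in>Rd d. f y \<ge> f x + inner_d d (grad_d d f x) (vsub_d d y x) + m / 2 * (norm_d d (vsub_d d y x))\<^sup>2)"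

definition target :: "nat \<Rightarrow> ((nat \<Rightarrow> real) \<Rightarrow> real) \<Rightarrow> (nat \<Rightarrow> real) measure" where
  "target d f = density (lebd d)
     (\<lambda>x. ennreal (exp (- f x) / (\<integral>z. exp (- f z) \<partial>lebd d)))"

text \<open>Density of the proposal N(x - h grad f(x), 2h I_d) at y.\<close>
definition prop_dens :: "nat \<Rightarrow> ((nat \<Rightarrow> real) \<Rightarrow> real) \<Rightarrow> real \<Rightarrow> (nat \<Rightarrow> real) \<Rightarrow> (nat \<Rightarrow> real) \<Rightarrow> real" where
  "prop_dens d f h x y = (4 * pi * h) powr (- real d / 2) *
     exp (- (norm_d d (\<lambda>i. y i - (x i - h * grad_d d f x i)))\<^sup>2 / (4 * h))"

text \<open>Acceptance probability min{1, pi(y)Q(y,x) / (pi(x)Q(x,y))}, with pi(y)/pi(x) = exp(f x - f y).\<close>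
definition accept :: "nat \<Rightarrow> ((nat \<Rightarrow> real) \<Rightarrow> real) \<Rightarrow> real \<Rightarrow> (nat \<Rightarrow> real) \<Rightarrow> (nat \<Rightarrow> real) \<Rightarrow> real" where
  "accept d f h x y = min 1 (exp (f x - f y) * prop_dens d f h y x / prop_dens d f h x y)"

definition mala_kernel :: "nat \<Rightarrow> ((nat \<Rightarrow> real) \<Rightarrow> real) \<Rightarrow> real \<Rightarrow> (nat \<Rightarrow> real) \<Rightarrow> (nat \<Rightarrow> real) set \<Rightarrow> ennreal" where
  "mala_kernel d f h x S =
     (\<integral>\<^sup>+ y. ennreal (accept d f h x y * prop_dens d f h x y) * indicator S y \<partial>lebd d)
     + (1 - (\<integral>\<^sup>+ y. ennreal (accept d f h x y * prop_dens d f h x y) \<partial>lebd d)) * indicator S x"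

definition mala_step :: "nat \<Rightarrow> ((nat \<Rightarrow> real) \<Rightarrow> real) \<Rightarrow> real \<Rightarrow> (nat \<Rightarrow> real) measure \<Rightarrow> (nat \<Rightarrow> real) measure" where
  "mala_step d f h \<mu> = measure_of (Rd d) (sets (lebd d)) (\<lambda>S. \<integral>\<^sup>+ x. mala_kernel d f h x S \<partial>\<mu>)"

definition mala_law :: "nat \<Rightarrow> ((nat \<Rightarrow> real) \<Rightarrow> real) \<Rightarrow> real \<Rightarrow> (nat \<Rightarrow> real) measure \<Rightarrow> nat \<Rightarrow> (nat \<Rightarrow> real) measure" where
  "mala_law d f h \<mu>0 n = (mala_step d f h ^^ n) \<mu>0"

definition tv_le :: "nat \<Rightarrow> (nat \<Rightarrow> real) measure \<Rightarrow> (nat \<Rightarrow> real) measure \<Rightarrow> real \<Rightarrow> bool" where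
  "tv_le d \<mu> \<nu> \<epsilon> \<longleftrightarrow> (\<forall>S\<in>sets (lebd d). \<bar>measure \<mu> S - measure \<nu> S\<bar> \<le> \<epsilon>)"

text \<open>Mixing time; infinite if the TV accuracy is never reached.\<close>
definition tau_tv :: "nat \<Rightarrow> ((nat \<Rightarrow> real) \<Rightarrow> real) \<Rightarrow> real \<Rightarrow> real \<Rightarrow> (nat \<Rightarrow> real) measure \<Rightarrow> enat" where
  "tau_tv d f h \<epsilon> \<mu>0 = Inf (enat ` {n. tv_le d (mala_law d f h \<mu>0 n) (target d f) \<epsilon>})"

definition warm :: "nat \<Rightarrow> real \<Rightarrow> ((nat \<Rightarrow> real) \<Rightarrow> real) \<Rightarrow> (nat \<Rightarrow> real) measure \<Rightarrow> bool" where
  "warm d M f \<mu>0 \<longleftrightarrow> prob_space \<mu>0 \<and> sets \<mu>0 = sets (lebd d) \<and>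
     (\<forall>S\<in>sets (lebd d). measure \<mu>0 S \<le> M * measure (target d f) S)"

definition mixing_time :: "nat \<Rightarrow> real \<Rightarrow> real \<Rightarrow> real \<Rightarrow> real \<Rightarrow> enat" where
  "mixing_time d L m \<epsilon> M =
     (INF h\<in>{h::real. h > 0}. SUP f\<in>{f. in_class d L m f}. SUP \<mu>0\<in>{\<mu>0. warm d M f \<mu>0}. tau_tv d f h \<epsilon> \<mu>0)"

end

theory Submission
  imports Defs "HOL-Real_Asymp.Real_Asymp"
begin

text \<open>
  For every step size h a separable target \<open>f x = \<Sum>i<d. u (x i)\<close> with
  \<open>u t = a t\<^sup>2 / 2 - dl cos (w t)\<close> is exhibited for which the test function
  \<open>g x = sin (sqrt a * x 0)\<close> has a small Dirichlet form \<open>\<E>\<close> but variance at least 1/8.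
  Started from the 2-warm law \<open>(1 + g) \<pi>\<close>, the chain has law \<open>(1 + P\<^sup>n g) \<pi>\<close> after n steps, and
  log-convexity of the even moments \<open>\<langle>g, P\<^sup>2\<^sup>k g\<rangle>\<close> of the reversible operator P bounds its
  total variation distance to \<open>\<pi>\<close> from below by a constant times \<open>(1 - 8 \<E>)\<^sup>n\<^sup>+\<^sup>1\<close>.

  If h is small, u is the Gaussian of curvature m and \<open>\<E> \<le> 3 m h / 2\<close>, since proposals hardly move.
  Otherwise \<open>\<E>\<close> is at most twice the mean acceptance probability at stationarity, which (as
  \<open>min x y \<le> sqrt (x y)\<close>) is at most the d-th power of the one-dimensional Bhattacharyya affinity of
  the laws of the pairs (current state, proposal) and (proposal, current state). This affinity is at most
  \<open>1 - D\<^sup>2 / 8\<close> for \<open>D = E (cos (w x) - cos (w y))\<close>. Since y carries independent noise of variance 2h,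
  \<open>\<bar>E cos (w y)\<bar> \<le> exp (- w\<^sup>2 h)\<close>, whereas \<open>E cos (w x)\<close> is of order dl because of the
  ripple in u (or of constant order for a Gaussian of curvature L when \<open>h L \<ge> 1\<close>).
\<close>

section \<open>Densities evolving under a reversible kernel\<close>

text \<open>\<open>k x y\<close> is the density of accepted moves from \<open>x\<close>; the mass it
  lacks is the probability of staying put. Balance is asked of \<open>k\<close> alone, because a
  holding atom on the diagonal is symmetric anyway.\<close>

locale reversible_kernel = sigma_finite_measure M for M :: "'a measure" +
  fixes p :: "'a \<Rightarrow> real" and k :: "'a \<Rightarrow> 'a \<Rightarrow> real"
  assumes p_measurable [measurable]: "p \<in> borel_measurable M"
    and p_nonneg: "p x \<ge> 0"
    and p_prob: "(\<integral>\<^sup>+x. p x \<partial>M) = 1"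
    and k_measurable [measurable]: "case_prod k \<in> borel_measurable (M \<Otimes>\<^sub>M M)"
    and k_nonneg: "k x y \<ge> 0"
    and k_sub: "x \<in> space M \<Longrightarrow> (\<integral>\<^sup>+y. k x y \<partial>M) \<le> 1"
    and balance: "x \<in> space M \<Longrightarrow> y \<in> space M \<Longrightarrow> p x * k x y = p y * k y x"
begin

sublocale P: pair_sigma_finite M M ..

definition mass :: "'a \<Rightarrow> real" where "mass x = (\<integral>y. k x y \<partial>M)"

definition op :: "('a \<Rightarrow> real) \<Rightarrow> 'a \<Rightarrow> real" where
  "op g x = (\<integral>y. k x y * g y \<partial>M) + (1 - mass x) * g x"

definition scal :: "('a \<Rightarrow> real) \<Rightarrow> ('a \<Rightarrow> real) \<Rightarrow> real" where
  "scal f g = (\<integral>x. p x * (f x * g x) \<partial>M)"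

text \<open>Bounds hold everywhere rather than almost everywhere, so the class is stable under the
  pointwise operator \<open>op\<close>. It takes the place of L2 and supplies integrability.\<close>

definition bdd :: "real \<Rightarrow> ('a \<Rightarrow> real) set" where
  "bdd B = {g \<in> borel_measurable M. \<forall>x\<in>space M. \<bar>g x\<bar> \<le> B}"

lemma bddD: "g \<in> bdd B \<Longrightarrow> g \<in> borel_measurable M" "g \<in> bdd B \<Longrightarrow> x \<in> space M \<Longrightarrow> \<bar>g x\<bar> \<le> B"
  by (auto simp: bdd_def)

lemma k_measurable1: "x \<in> space M \<Longrightarrow> k x \<in> borel_measurable M"
  by measurable

lemma k_integrable: "x \<in> space M \<Longrightarrow> integrable M (k x)"
  using k_sub[of x] k_measurable1[of x] k_nonneg
  by (intro integrableI_bounded) (auto simp: less_eq_ennreal_def top.not_eq_extremum[symmetric] top_unique)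

lemma nn_mass: "x \<in> space M \<Longrightarrow> (\<integral>\<^sup>+y. k x y \<partial>M) = ennreal (mass x)"
  unfolding mass_def using k_integrable k_nonneg by (intro nn_integral_eq_integral) auto

lemma mass_nonneg: "mass x \<ge> 0"
  unfolding mass_def using k_nonneg by simp

lemma mass_le: "x \<in> space M \<Longrightarrow> mass x \<le> 1"
  using nn_mass[of x] k_sub[of x] by simp

lemma mass_measurable [measurable]: "mass \<in> borel_measurable M"
  unfolding mass_def by measurable

lemma p_integrable: "integrable M p"
  using p_prob p_nonneg by (intro integrableI_bounded) auto

lemma p_integral: "(\<integral>x. p x \<partial>M) = 1"
  using p_prob p_nonneg by (subst integral_eq_nn_integral) auto

lemma k_integrable_mult:
  assumes "g \<in> bdd B" "x \<in> space M"
  shows "integrable M (\<lambda>y. k x y * g y)"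
proof (rule Bochner_Integration.integrable_bound[of _ "\<lambda>y. B * k x y"])
  show "AE y in M. norm (k x y * g y) \<le> norm (B * k x y)"
  proof (rule AE_I2)
    fix y assume "y \<in> space M"
    then have "\<bar>g y\<bar> \<le> \<bar>B\<bar>" using bddD(2)[OF assms(1)] by fastforce
    then show "norm (k x y * g y) \<le> norm (B * k x y)"
      using k_nonneg[of x y] by (simp add: abs_mult mult_right_mono mult.commute[of "k x y"])
  qed
qed (use assms k_integrable bddD(1)[OF assms(1)] k_measurable1 in auto)

lemma p_integrable_mult:
  assumes "g \<in> bdd B"
  shows "integrable M (\<lambda>y. p y * g y)"
proof (rule Bochner_Integration.integrable_bound[of _ "\<lambda>y. B * p y"])
  show "AE y in M. norm (p y * g y) \<le> norm (B * p y)"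
  proof (rule AE_I2)
    fix y assume "y \<in> space M"
    then have "\<bar>g y\<bar> \<le> \<bar>B\<bar>" using bddD(2)[OF assms(1)] by fastforce
    then show "norm (p y * g y) \<le> norm (B * p y)"
      using p_nonneg[of y] by (simp add: abs_mult mult_right_mono mult.commute[of "p y"])
  qed
qed (use assms p_integrable bddD(1)[OF assms(1)] in auto)

lemma bdd_mult: "f \<in> bdd B \<Longrightarrow> g \<in> bdd C \<Longrightarrow> (\<lambda>x. f x * g x) \<in> bdd (B * C)"
  by (auto simp: bdd_def abs_mult intro!: mult_mono' order_trans[OF abs_ge_zero])

lemma scal_integrable: "f \<in> bdd B \<Longrightarrow> g \<in> bdd C \<Longrightarrow> integrable M (\<lambda>x. p x * (f x * g x))"
  using p_integrable_mult[OF bdd_mult] by blast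

text \<open>\<open>op g x\<close> averages values of \<open>g\<close> with weights
  \<open>mass x\<close> and \<open>1 - mass x\<close>, so the supremum norm does not grow.\<close>

lemma op_bdd:
  assumes "g \<in> bdd B"
  shows "op g \<in> bdd B"
proof -
  have [measurable]: "g \<in> borel_measurable M" using assms by (rule bddD)
  have "\<bar>op g x\<bar> \<le> B" if x: "x \<in> space M" for x
  proof -
    have "\<bar>\<integral>y. k x y * g y \<partial>M\<bar> \<le> (\<integral>y. \<bar>k x y * g y\<bar> \<partial>M)"
      using integral_norm_bound[of M "\<lambda>y. k x y * g y"] by simp
    also have "\<dots> \<le> (\<integral>y. B * k x y \<partial>M)"
      using k_integrable_mult[OF assms x] k_integrable[OF x] bddD(2)[OF assms] k_nonneg
      by (intro integral_mono integrable_abs) (auto simp: abs_mult mult.commute[of "k x _"] mult_right_mono)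
    also have "\<dots> = B * mass x" unfolding mass_def by simp
    finally have 1: "\<bar>\<integral>y. k x y * g y \<partial>M\<bar> \<le> B * mass x" .
    have 2: "\<bar>(1 - mass x) * g x\<bar> \<le> (1 - mass x) * B"
      using mass_le[OF x] bddD(2)[OF assms x] by (simp add: abs_mult mult_left_mono)
    have "\<bar>op g x\<bar> \<le> B * mass x + (1 - mass x) * B"
      unfolding op_def by (rule order_trans[OF abs_triangle_ineq add_mono[OF 1 2]])
    then show ?thesis by (simp add: algebra_simps)
  qed
  then show ?thesis unfolding bdd_def op_def by auto
qed

lemma op_pow_bdd: "g \<in> bdd B \<Longrightarrow> (op ^^ n) g \<in> bdd B"
  by (induction n) (auto intro: op_bdd)

section \<open>Self-adjointness and the Dirichlet form\<close>

lemma pk_integrable: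
  assumes [measurable]: "F \<in> borel_measurable (M \<Otimes>\<^sub>M M)"
    and B: "\<And>x y. x \<in> space M \<Longrightarrow> y \<in> space M \<Longrightarrow> \<bar>F (x, y)\<bar> \<le> B"
  shows "integrable (M \<Otimes>\<^sub>M M) (\<lambda>(x, y). p x * k x y * F (x, y))"
proof (rule Bochner_Integration.integrable_bound[of _ "\<lambda>(x, y). B * (p x * k x y)"])
  have "integrable (M \<Otimes>\<^sub>M M) (\<lambda>(x, y). p x * k x y)"
  proof (rule P.Fubini_integrable)
    have "integrable M (\<lambda>x. p x * mass x)"
      by (rule Bochner_Integration.integrable_bound[OF p_integrable])
        (use mass_le mass_nonneg p_nonneg in \<open>auto simp: abs_mult mult_left_le\<close>)
    then show "integrable M (\<lambda>x. \<integral>y. norm (case (x, y) of (x, y) \<Rightarrow> p x * k x y) \<partial>M)"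
      using p_nonneg k_nonneg by (simp add: abs_mult mass_def)
  qed (use k_integrable in auto)
  then show "integrable (M \<Otimes>\<^sub>M M) (\<lambda>(x, y). B * (p x * k x y))"
    using integrable_mult_right[of B "M \<Otimes>\<^sub>M M" "\<lambda>(x, y). p x * k x y"] by (simp add: case_prod_unfold)
  show "AE z in M \<Otimes>\<^sub>M M. norm (case z of (x, y) \<Rightarrow> p x * k x y * F (x, y)) \<le> norm (case z of (x, y) \<Rightarrow> B * (p x * k x y))"
  proof (rule AE_I2, clarsimp simp: space_pair_measure abs_mult)
    fix x y assume "x \<in> space M" "y \<in> space M"
    then have "\<bar>F (x,y)\<bar> \<le> \<bar>B\<bar>" using B by fastforce
    then show "\<bar>p x\<bar> * \<bar>k x y\<bar> * \<bar>F (x, y)\<bar> \<le> \<bar>B\<bar> * (\<bar>p x\<bar> * \<bar>k x y\<bar>)"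
      by (metis abs_ge_zero mult.commute mult_left_mono mult_nonneg_nonneg)
  qed
qed measurable

text \<open>Detailed balance says that the measure \<open>p x * k x y\<close> on pairs is invariant
  under exchanging the coordinates.\<close>

lemma pk_swap:
  "(\<integral>(x, y). p x * k x y * F (x, y) \<partial>(M \<Otimes>\<^sub>M M)) = (\<integral>(x, y). p x * k x y * F (y, x) \<partial>(M \<Otimes>\<^sub>M M))"
  if [measurable]: "F \<in> borel_measurable (M \<Otimes>\<^sub>M M)"
proof -
  have "(\<integral>(x, y). p x * k x y * F (x, y) \<partial>(M \<Otimes>\<^sub>M M)) = (\<integral>(x, y). p y * k y x * F (y, x) \<partial>(M \<Otimes>\<^sub>M M))"
    by (subst P.integral_product_swap[symmetric]) (auto simp: case_prod_unfold)
  also have "\<dots> = (\<integral>(x, y). p x * k x y * F (y, x) \<partial>(M \<Otimes>\<^sub>M M))"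
    by (rule Bochner_Integration.integral_cong) (auto simp: space_pair_measure balance)
  finally show ?thesis .
qed

text \<open>Separates jumps from holding. The holding part is visibly symmetric in \<open>f\<close>
  and \<open>g\<close>, so only the double integral calls for reversibility.\<close>

lemma scal_op:
  assumes f: "f \<in> bdd B" and g: "g \<in> bdd C"
  shows "scal f (op g) = (\<integral>(x, y). p x * k x y * (f x * g y) \<partial>(M \<Otimes>\<^sub>M M)) + (\<integral>x. p x * ((1 - mass x) * (f x * g x)) \<partial>M)"
proof -
  have [measurable]: "f \<in> borel_measurable M" "g \<in> borel_measurable M" using f g by (auto dest: bddD)
  have int: "integrable (M \<Otimes>\<^sub>M M) (\<lambda>(x, y). p x * k x y * (f x * g y))"
    using pk_integrable[of "\<lambda>(x,y). f x * g y" "B * C"] bddD(2)[OF f] bddD(2)[OF g]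
    by (auto simp: abs_mult intro!: mult_mono' order_trans[OF abs_ge_zero])
  have m: "(\<lambda>x. 1 - mass x) \<in> bdd 1"
    using mass_le mass_nonneg by (auto simp: bdd_def)
  have "(\<integral>(x, y). p x * k x y * (f x * g y) \<partial>(M \<Otimes>\<^sub>M M)) = (\<integral>x. \<integral>y. p x * k x y * (f x * g y) \<partial>M \<partial>M)"
    using P.integral_fst'[OF int] by simp
  also have "\<dots> = (\<integral>x. p x * (f x * (\<integral>y. k x y * g y \<partial>M)) \<partial>M)"
    by (intro Bochner_Integration.integral_cong refl)
      (simp add: mult_ac flip: integral_mult_right_zero)
  finally have 1: "(\<integral>(x, y). p x * k x y * (f x * g y) \<partial>(M \<Otimes>\<^sub>M M)) = (\<integral>x. p x * (f x * (\<integral>y. k x y * g y \<partial>M)) \<partial>M)" .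
  have i1: "integrable M (\<lambda>x. p x * (f x * (\<integral>y. k x y * g y \<partial>M)))"
  proof -
    have "integrable M (\<lambda>x. \<integral>y. p x * k x y * (f x * g y) \<partial>M)"
      using P.integrable_fst'[OF int] by simp
    then show ?thesis by (simp add: mult_ac flip: integral_mult_right_zero)
  qed
  have i2: "integrable M (\<lambda>x. p x * ((1 - mass x) * (f x * g x)))"
    using p_integrable_mult[OF bdd_mult[OF m bdd_mult[OF f g]]] .
  show ?thesis unfolding 1 scal_def op_def
    by (subst Bochner_Integration.integral_add[OF i1 i2, symmetric]) (simp add: algebra_simps)
qed

lemma scal_commute: "scal f g = scal g f"
  unfolding scal_def by (simp add: mult.commute)

lemma op_sym:
  assumes f: "f \<in> bdd B" and g: "g \<in> bdd C"
  shows "scal f (op g) = scal (op f) g"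
proof -
  have [measurable]: "f \<in> borel_measurable M" "g \<in> borel_measurable M" using f g by (auto dest: bddD)
  show ?thesis
    unfolding scal_commute[of "op f"] scal_op[OF f g] scal_op[OF g f]
    using pk_swap[of "\<lambda>(x, y). f x * g y"] by (simp add: mult.commute)
qed

text \<open>Holding cancels in the difference. In the jump part, symmetry gives
  \<open>g x * g x\<close> and \<open>g y * g y\<close> the same integral, and half of each
  completes the square.\<close>

lemma dirichlet:
  assumes g: "g \<in> bdd B"
  shows "scal g g - scal g (op g) = (\<integral>(x, y). p x * k x y * ((g x - g y)\<^sup>2 / 2) \<partial>(M \<Otimes>\<^sub>M M))"
proof -
  have [measurable]: "g \<in> borel_measurable M" using g by (auto dest: bddD)
  have b: "\<bar>g x * g y\<bar> \<le> B * B" if "x \<in> space M" "y \<in> space M" for x y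
    using bddD(2)[OF g] that by (auto simp: abs_mult intro!: mult_mono' order_trans[OF abs_ge_zero])
  have int1: "integrable (M \<Otimes>\<^sub>M M) (\<lambda>(x, y). p x * k x y * (g x * g y))"
    using pk_integrable[of "\<lambda>(x,y). g x * g y" "B * B"] b by auto
  have int2: "integrable (M \<Otimes>\<^sub>M M) (\<lambda>(x, y). p x * k x y * (g x * g x))"
    using pk_integrable[of "\<lambda>(x,y). g x * g x" "B * B"] b[of x x for x] by (auto simp: abs_mult)
  have int3: "integrable (M \<Otimes>\<^sub>M M) (\<lambda>(x, y). p x * k x y * (g y * g y))"
    using pk_integrable[of "\<lambda>(x,y). g y * g y" "B * B"] b[of x x for x] by (auto simp: abs_mult)
  have e: "(\<integral>(x, y). p x * k x y * (g x * g x) \<partial>(M \<Otimes>\<^sub>M M)) = (\<integral>(x, y). p x * k x y * (g y * g y) \<partial>(M \<Otimes>\<^sub>M M))"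
    using pk_swap[of "\<lambda>(x, y). g x * g x"] by simp
  have m: "mass \<in> bdd 1" "(\<lambda>x. 1 - mass x) \<in> bdd 1"
    using mass_le mass_nonneg by (auto simp: bdd_def)
  have "(\<integral>(x, y). p x * k x y * (g x * g x) \<partial>(M \<Otimes>\<^sub>M M)) = (\<integral>x. \<integral>y. p x * k x y * (g x * g x) \<partial>M \<partial>M)"
    using P.integral_fst'[OF int2] by simp
  also have "\<dots> = (\<integral>x. p x * (mass x * (g x * g x)) \<partial>M)"
    unfolding mass_def by (intro Bochner_Integration.integral_cong refl)
      (simp add: mult_ac flip: integral_mult_right_zero)
  finally have "(\<integral>(x, y). p x * k x y * (g x * g x) \<partial>(M \<Otimes>\<^sub>M M)) + (\<integral>x. p x * ((1 - mass x) * (g x * g x)) \<partial>M) = scal g g"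
    unfolding scal_def
    using Bochner_Integration.integral_add[OF p_integrable_mult[OF bdd_mult[OF m(1) bdd_mult[OF g g]]] p_integrable_mult[OF bdd_mult[OF m(2) bdd_mult[OF g g]]]]
    by (simp add: algebra_simps)
  then have "scal g g - scal g (op g) = (\<integral>(x, y). p x * k x y * (g x * g x) \<partial>(M \<Otimes>\<^sub>M M)) - (\<integral>(x, y). p x * k x y * (g x * g y) \<partial>(M \<Otimes>\<^sub>M M))"
    unfolding scal_op[OF g g] by simp
  also have "\<dots> = (\<integral>(x, y). p x * k x y * (g x * g x) \<partial>(M \<Otimes>\<^sub>M M)) / 2 + (\<integral>(x, y). p x * k x y * (g y * g y) \<partial>(M \<Otimes>\<^sub>M M)) / 2 - (\<integral>(x, y). p x * k x y * (g x * g y) \<partial>(M \<Otimes>\<^sub>M M))"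
    using e by simp
  also have "\<dots> = (\<integral>z. (case z of (x, y) \<Rightarrow> p x * k x y * (g x * g x)) / 2 + (case z of (x, y) \<Rightarrow> p x * k x y * (g y * g y)) / 2
      - (case z of (x, y) \<Rightarrow> p x * k x y * (g x * g y)) \<partial>(M \<Otimes>\<^sub>M M))"
    using int1 int2 int3 by simp
  also have "\<dots> = (\<integral>(x, y). p x * k x y * ((g x - g y)\<^sup>2 / 2) \<partial>(M \<Otimes>\<^sub>M M))"
    by (intro Bochner_Integration.integral_cong refl) (auto simp: power2_eq_square field_simps)
  finally show ?thesis .
qed

text \<open>The quadratic form of \<open>s * f - t * g\<close> is nonnegative. As
  \<open>scal\<close> is only semidefinite on functions, \<open>scal g g = 0\<close> is a case of
  its own.\<close>

lemma scal_Cauchy_Schwarz: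
  assumes f: "f \<in> bdd B" and g: "g \<in> bdd C"
  shows "(scal f g)\<^sup>2 \<le> scal f f * scal g g"
proof -
  have q: "0 \<le> s\<^sup>2 * scal f f - 2 * s * t * scal f g + t\<^sup>2 * scal g g" for s t
  proof -
    have "0 \<le> (\<integral>x. p x * (s * f x - t * g x)\<^sup>2 \<partial>M)"
      using p_nonneg by simp
    also have "\<dots> = (\<integral>x. s\<^sup>2 * (p x * (f x * f x)) - 2 * s * t * (p x * (f x * g x)) + t\<^sup>2 * (p x * (g x * g x)) \<partial>M)"
      by (intro Bochner_Integration.integral_cong) (auto simp: power2_eq_square algebra_simps)
    also have "\<dots> = s\<^sup>2 * scal f f - 2 * s * t * scal f g + t\<^sup>2 * scal g g"
      unfolding scal_def using scal_integrable[OF f f] scal_integrable[OF f g] scal_integrable[OF g g] by simp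
    finally show ?thesis .
  qed
  have nn: "scal f f \<ge> 0" "scal g g \<ge> 0" using q[of 1 0] q[of 0 1] by auto
  show ?thesis
  proof (cases "scal g g = 0")
    case True
    have "scal f g = 0"
    proof (rule ccontr)
      assume n: "scal f g \<noteq> 0"
      \<comment> \<open>With \<open>scal g g = 0\<close> and \<open>s = 1\<close> the form is affine
        in \<open>t\<close>; this \<open>t\<close> makes its value -1.\<close>
      have "0 \<le> scal f f - 2 * ((scal f f + 1) / (2 * scal f g)) * scal f g"
        using q[of 1 "(scal f f + 1) / (2 * scal f g)"] True by simp
      then show False using n by simp
    qed
    then show ?thesis using nn by simp
  next
    case False
    have "0 \<le> scal g g * (scal f f * scal g g - (scal f g)\<^sup>2)"
      using q[of "scal g g" "scal f g"] by (simp add: power2_eq_square algebra_simps)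
    then show ?thesis using nn False by (simp add: zero_le_mult_iff)
  qed
qed

section \<open>Moments of a test function under the iterated operator\<close>

definition mom :: "('a \<Rightarrow> real) \<Rightarrow> nat \<Rightarrow> real" where
  "mom g n = scal g ((op ^^ n) g)"

lemma scal_pow:
  assumes g: "g \<in> bdd B"
  shows "scal ((op ^^ i) g) ((op ^^ j) g) = mom g (i + j)"
proof (induction i arbitrary: j)
  case (Suc i)
  have "scal ((op ^^ Suc i) g) ((op ^^ j) g) = scal ((op ^^ i) g) ((op ^^ Suc j) g)"
    using op_sym[OF op_pow_bdd[OF g] op_pow_bdd[OF g], of i j] by simp
  then show ?case using Suc[of "Suc j"] by simp
qed (simp add: mom_def)

text \<open>Cauchy-Schwarz for \<open>(op ^^ i) g\<close> and \<open>(op ^^ j) g\<close>. The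
  bounding moments have even index, hence are squared norms even if \<open>op\<close> has negative
  spectrum.\<close>

lemma mom_logconvex: "g \<in> bdd B \<Longrightarrow> (mom g (i + j))\<^sup>2 \<le> mom g (i + i) * mom g (j + j)"
  using scal_Cauchy_Schwarz[OF op_pow_bdd op_pow_bdd, of g B g B i j] by (simp add: scal_pow)

text \<open>By log-convexity the ratio of consecutive even moments never decreases, and the first
  ratio is at least r^2 because the square of \<open>mom g 1\<close> is at most
  \<open>mom g 0 * mom g 2\<close>.\<close>

lemma mom_even_lower:
  assumes g: "g \<in> bdd B" and r: "0 < r" "r * mom g 0 \<le> mom g 1" and pos: "mom g 0 > 0"
  shows "mom g (2 * n) \<ge> mom g 0 * r ^ (2 * n)"
proof -
  \<comment> \<open>Positivity is carried along so that the common factor can be cancelled in the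
    induction step.\<close>
  have "mom g (2 * n) > 0 \<and> r\<^sup>2 * mom g (2 * n) \<le> mom g (2 * Suc n)" for n
  proof (induction n)
    case 0
    have "(r * mom g 0)\<^sup>2 \<le> (mom g 1)\<^sup>2" using r pos by (intro power_mono) auto
    also have "\<dots> \<le> mom g 0 * mom g 2" using mom_logconvex[OF g, of 0 1] by (simp add: numeral_2_eq_2)
    finally have "mom g 0 * (r\<^sup>2 * mom g 0) \<le> mom g 0 * mom g 2"
      by (simp add: power2_eq_square mult_ac)
    then show ?case using pos by (simp add: numeral_2_eq_2)
  next
    case (Suc n)
    let ?a = "mom g (2 * n)" and ?b = "mom g (2 * Suc n)" and ?c = "mom g (2 * Suc (Suc n))"
    have bp: "?b > 0"
      using Suc r(1) by (smt (verit) mult_pos_pos zero_less_power)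
    have "?b * ?b \<le> ?a * ?c"
      using mom_logconvex[OF g, of n "Suc (Suc n)"] by (simp add: power2_eq_square mult_2)
    moreover have "(r\<^sup>2 * ?a) * ?b \<le> ?b * ?b" using Suc bp by (intro mult_right_mono) auto
    ultimately have "?a * (r\<^sup>2 * ?b) \<le> ?a * ?c" by (simp add: mult_ac)
    then show ?case using bp Suc by simp
  qed
  note * = this
  show ?thesis
  proof (induction n)
    case (Suc n)
    have "mom g 0 * r ^ (2 * Suc n) = r\<^sup>2 * (mom g 0 * r ^ (2 * n))"
      by (simp add: power2_eq_square)
    also have "\<dots> \<le> r\<^sup>2 * mom g (2 * n)" using Suc by (intro mult_left_mono) auto
    also have "\<dots> \<le> mom g (2 * Suc n)" using *[of n] by simp
    finally show ?case .
  qed simp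
qed

lemma op_add_one:
  assumes g: "g \<in> bdd B" and x: "x \<in> space M" and f: "\<And>y. y \<in> space M \<Longrightarrow> f y = 1 + g y"
  shows "op f x = 1 + op g x"
proof -
  have "(\<integral>y. k x y * f y \<partial>M) = (\<integral>y. k x y + k x y * g y \<partial>M)"
    using f by (intro Bochner_Integration.integral_cong) (auto simp: algebra_simps)
  also have "\<dots> = mass x + (\<integral>y. k x y * g y \<partial>M)"
    unfolding mass_def using k_integrable[OF x] k_integrable_mult[OF g x] by simp
  finally show ?thesis unfolding op_def using f[OF x] by (simp add: algebra_simps)
qed

section \<open>Evolution of laws and total variation\<close>

definition law :: "('a \<Rightarrow> real) \<Rightarrow> 'a measure" where
  "law r = density M (\<lambda>x. ennreal (p x * r x))"

text \<open>The laws are the densities \<open>p r\<close>; by detailed balance the dual step acts on \<open>r\<close> through \<open>op\<close> itself.\<close>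
lemma nn_step:
  assumes r: "r \<in> bdd B" "\<And>x. x \<in> space M \<Longrightarrow> r x \<ge> 0" and S [measurable]: "S \<in> sets M"
  shows "(\<integral>\<^sup>+x. ((\<integral>\<^sup>+y. ennreal (k x y) * indicator S y \<partial>M)
     + (1 - (\<integral>\<^sup>+y. ennreal (k x y) \<partial>M)) * indicator S x) \<partial>(law r)) = emeasure (law (op r)) S"
proof -
  have [measurable]: "r \<in> borel_measurable M" "op r \<in> borel_measurable M"
    using r(1) op_bdd[OF r(1)] by (auto dest: bddD)
  have c: "x \<in> space M \<Longrightarrow> 1 - ennreal (mass x) = ennreal (1 - mass x)" for x
    using mass_nonneg[of x] by (simp flip: ennreal_1 add: ennreal_minus)
  have "(\<integral>\<^sup>+x. ((\<integral>\<^sup>+y. ennreal (k x y) * indicator S y \<partial>M)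
     + (1 - (\<integral>\<^sup>+y. ennreal (k x y) \<partial>M)) * indicator S x) \<partial>(law r))
    = (\<integral>\<^sup>+x. ((\<integral>\<^sup>+y. ennreal (k x y) * indicator S y \<partial>M)
     + ennreal (1 - mass x) * indicator S x) \<partial>(law r))"
    by (intro nn_integral_cong) (simp add: law_def nn_mass c)
  also have "\<dots> = (\<integral>\<^sup>+x. ennreal (p x * r x) * ((\<integral>\<^sup>+y. ennreal (k x y) * indicator S y \<partial>M)
     + ennreal (1 - mass x) * indicator S x) \<partial>M)"
    unfolding law_def by (subst nn_integral_density) auto
  also have "\<dots> = (\<integral>\<^sup>+x. (\<integral>\<^sup>+y. ennreal (p x * r x) * (ennreal (k x y) * indicator S y) \<partial>M)
     + ennreal (p x * r x) * (ennreal (1 - mass x) * indicator S x) \<partial>M)"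
    by (intro nn_integral_cong) (simp add: distrib_left nn_integral_cmult)
  also have "\<dots> = (\<integral>\<^sup>+x. (\<integral>\<^sup>+y. ennreal (p x * r x) * (ennreal (k x y) * indicator S y) \<partial>M) \<partial>M)
     + (\<integral>\<^sup>+x. ennreal (p x * r x) * (ennreal (1 - mass x) * indicator S x) \<partial>M)"
    by (intro nn_integral_add) auto
  \<comment> \<open>Tonelli brings the starting point inside, where balance replaces
    \<open>p x * k x y\<close> by \<open>p y * k y x\<close>.\<close>
  also have "(\<integral>\<^sup>+x. (\<integral>\<^sup>+y. ennreal (p x * r x) * (ennreal (k x y) * indicator S y) \<partial>M) \<partial>M)
    = (\<integral>\<^sup>+y. (\<integral>\<^sup>+x. ennreal (p x * r x) * (ennreal (k x y) * indicator S y) \<partial>M) \<partial>M)"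
    by (rule P.Fubini'[symmetric]) measurable
  also have "\<dots> = (\<integral>\<^sup>+y. ennreal (p y) * ennreal (\<integral>x. k y x * r x \<partial>M) * indicator S y \<partial>M)"
  proof (intro nn_integral_cong)
    fix y assume y: "y \<in> space M"
    have "(\<integral>\<^sup>+x. ennreal (p x * r x) * (ennreal (k x y) * indicator S y) \<partial>M)
      = (\<integral>\<^sup>+x. (ennreal (p y) * indicator S y) * ennreal (k y x * r x) \<partial>M)"
    proof (intro nn_integral_cong)
      fix x assume x: "x \<in> space M"
      have "ennreal (p x * r x) * ennreal (k x y) = ennreal ((p x * k x y) * r x)"
        using p_nonneg r(2)[OF x] k_nonneg by (simp add: mult_ac flip: ennreal_mult)
      also have "\<dots> = ennreal (p y) * ennreal (k y x * r x)"
        unfolding balance[OF x y] using p_nonneg r(2)[OF x] k_nonneg by (simp add: mult_ac flip: ennreal_mult)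
      finally show "ennreal (p x * r x) * (ennreal (k x y) * indicator S y) = (ennreal (p y) * indicator S y) * ennreal (k y x * r x)"
        by (simp add: mult_ac)
    qed
    also have "\<dots> = (ennreal (p y) * indicator S y) * (\<integral>\<^sup>+x. ennreal (k y x * r x) \<partial>M)"
      using y by (intro nn_integral_cmult) measurable
    also have "(\<integral>\<^sup>+x. ennreal (k y x * r x) \<partial>M) = ennreal (\<integral>x. k y x * r x \<partial>M)"
      using k_integrable_mult[OF r(1) y] r(2) k_nonneg by (intro nn_integral_eq_integral) auto
    finally show "(\<integral>\<^sup>+x. ennreal (p x * r x) * (ennreal (k x y) * indicator S y) \<partial>M)
       = ennreal (p y) * ennreal (\<integral>x. k y x * r x \<partial>M) * indicator S y"
      by (simp add: mult_ac)
  qed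
  also have "\<dots> + (\<integral>\<^sup>+x. ennreal (p x * r x) * (ennreal (1 - mass x) * indicator S x) \<partial>M)
    = (\<integral>\<^sup>+x. ennreal (p x) * ennreal (\<integral>y. k x y * r y \<partial>M) * indicator S x
       + ennreal (p x * r x) * (ennreal (1 - mass x) * indicator S x) \<partial>M)"
    by (rule nn_integral_add[symmetric]) auto
  also have "\<dots> = (\<integral>\<^sup>+x. ennreal (p x * op r x) * indicator S x \<partial>M)"
  proof (intro nn_integral_cong)
    fix x assume x: "x \<in> space M"
    have "(\<integral>y. k x y * r y \<partial>M) \<ge> 0" using k_nonneg r(2) by (intro integral_nonneg_AE) auto
    then have "ennreal (p x) * ennreal (\<integral>y. k x y * r y \<partial>M) + ennreal (p x * r x) * ennreal (1 - mass x)
        = ennreal (p x * (\<integral>y. k x y * r y \<partial>M) + p x * r x * (1 - mass x))"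
      using p_nonneg[of x] r(2)[OF x] mass_le[OF x] by (simp flip: ennreal_mult ennreal_plus)
    also have "\<dots> = ennreal (p x * op r x)" by (simp add: op_def algebra_simps)
    finally have "ennreal (p x) * ennreal (\<integral>y. k x y * r y \<partial>M) + ennreal (p x * r x) * ennreal (1 - mass x) = ennreal (p x * op r x)" .
    then show "ennreal (p x) * ennreal (\<integral>y. k x y * r y \<partial>M) * indicator S x
       + ennreal (p x * r x) * (ennreal (1 - mass x) * indicator S x) = ennreal (p x * op r x) * indicator S x"
      by (metis (no_types, lifting) distrib_right mult.assoc)
  qed
  also have "\<dots> = emeasure (law (op r)) S"
    unfolding law_def by (subst emeasure_density) auto
  finally show ?thesis .
qed

lemma measure_law:
  assumes r: "r \<in> bdd B" "\<And>x. x \<in> space M \<Longrightarrow> r x \<ge> 0" and S [measurable]: "S \<in> sets M"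
  shows "measure (law r) S = (\<integral>x. p x * (r x * indicator S x) \<partial>M)"
proof -
  have [measurable]: "r \<in> borel_measurable M" using r by (auto dest: bddD)
  have "(indicator S :: 'a \<Rightarrow> real) \<in> bdd 1" by (auto simp: bdd_def indicator_def)
  from scal_integrable[OF r(1) this]
  have "emeasure (law r) S = ennreal (\<integral>x. p x * (r x * indicator S x) \<partial>M)"
    unfolding law_def using r p_nonneg
    by (subst emeasure_density) (auto simp: ennreal_indicator[symmetric] mult_ac simp flip: ennreal_mult'' nn_integral_eq_integral intro!: nn_integral_cong)
  then show ?thesis
    unfolding measure_def using r p_nonneg by (simp add: integral_nonneg_AE)
qed

text \<open>The sign of \<open>v\<close> splits the space into two sets, and each contributes at
  most \<open>e\<close> to the integral of \<open>p x * \<bar>v x\<bar>\<close>, which dominates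
  \<open>scal w v\<close>.\<close>

lemma abs_scal_le_tv:
  assumes w: "w \<in> bdd 1" and v: "v \<in> bdd B" "\<And>x. x \<in> space M \<Longrightarrow> 1 + v x \<ge> 0"
    and tv: "\<And>S. S \<in> sets M \<Longrightarrow> \<bar>measure (law (\<lambda>x. 1 + v x)) S - measure (law (\<lambda>_. 1)) S\<bar> \<le> e"
  shows "scal w v \<le> 2 * e"
proof -
  have [measurable]: "v \<in> borel_measurable M" "w \<in> borel_measurable M" using v w by (auto dest: bddD)
  define S where "S = {x \<in> space M. v x \<ge> 0}"
  have [measurable]: "S \<in> sets M" unfolding S_def by measurable
  have v1: "(\<lambda>x. 1 + v x) \<in> bdd (1 + B)" using v(1) by (auto simp: bdd_def intro: order_trans[OF abs_triangle_ineq])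
  have o: "(\<lambda>x. 1) \<in> bdd 1" by (auto simp: bdd_def)
  have i: "(indicator A :: 'a \<Rightarrow> real) \<in> bdd 1" if "A \<in> sets M" for A using that by (auto simp: bdd_def indicator_def)
  have d: "measure (law (\<lambda>x. 1 + v x)) A - measure (law (\<lambda>_. 1)) A = (\<integral>x. p x * (v x * indicator A x) \<partial>M)"
    if A: "A \<in> sets M" for A
  proof -
    have "measure (law (\<lambda>x. 1 + v x)) A - measure (law (\<lambda>_. 1)) A
      = (\<integral>x. p x * ((1 + v x) * indicator A x) \<partial>M) - (\<integral>x. p x * (1 * indicator A x) \<partial>M)"
      using measure_law[OF v1 v(2) A] measure_law[OF o _ A] by simp
    also have "\<dots> = (\<integral>x. p x * ((1 + v x) * indicator A x) - p x * (1 * indicator A x) \<partial>M)"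
      by (rule Bochner_Integration.integral_diff[symmetric, OF scal_integrable[OF v1 i[OF A]] scal_integrable[OF o i[OF A]]])
    finally show ?thesis by (simp add: algebra_simps)
  qed
  have "scal w v \<le> (\<integral>x. p x * (v x * indicator S x) - p x * (v x * indicator (space M - S) x) \<partial>M)"
    unfolding scal_def
  proof (rule integral_mono)
    fix x assume x: "x \<in> space M"
    have "w x * v x \<le> \<bar>w x\<bar> * \<bar>v x\<bar>" by (simp flip: abs_mult)
    also have "\<dots> \<le> 1 * \<bar>v x\<bar>" using bddD(2)[OF w x] by (intro mult_right_mono) auto
    also have "\<dots> = v x * indicator S x - v x * indicator (space M - S) x"
      using x by (auto simp: S_def indicator_def)
    finally have "p x * (w x * v x) \<le> p x * (v x * indicator S x - v x * indicator (space M - S) x)"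
      using p_nonneg by (intro mult_left_mono) auto
    then show "p x * (w x * v x) \<le> p x * (v x * indicator S x) - p x * (v x * indicator (space M - S) x)"
      by (simp add: algebra_simps)
  qed (intro Bochner_Integration.integrable_diff scal_integrable[OF w v(1)] scal_integrable[OF v(1) i]; simp)+
  also have "\<dots> = (\<integral>x. p x * (v x * indicator S x) \<partial>M) - (\<integral>x. p x * (v x * indicator (space M - S) x) \<partial>M)"
    by (intro Bochner_Integration.integral_diff scal_integrable[OF v(1) i]) auto
  also have "\<dots> \<le> e + e"
    using tv[of S] tv[of "space M - S"] d[of S] d[of "space M - S"] by auto
  finally show ?thesis by simp
qed

lemma op_pow_density:
  assumes g: "g \<in> bdd 1"
  shows "(\<lambda>x. 1 + (op ^^ n) g x) \<in> bdd 2" "x \<in> space M \<Longrightarrow> 1 + (op ^^ n) g x \<ge> 0"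
  using op_pow_bdd[OF g, of n] by (fastforce simp: bdd_def)+

text \<open>Only even moments are controlled, so \<open>n\<close> is rounded up to an even number.
  The extra power goes to the test function: \<open>(op ^^ (n mod 2)) g\<close> is still bounded by
  1 and is paired with the deviation \<open>(op ^^ n) g\<close> of the density from 1.\<close>

lemma mixing_lower:
  assumes g: "g \<in> bdd 1" and r: "0 < r" "r \<le> 1" "r * mom g 0 \<le> mom g 1" and pos: "mom g 0 > 0"
    and tv: "\<And>S. S \<in> sets M \<Longrightarrow> \<bar>measure (law (\<lambda>x. 1 + (op ^^ n) g x)) S - measure (law (\<lambda>_. 1)) S\<bar> \<le> e"
  shows "mom g 0 * r ^ (2 * ((n + 1) div 2)) \<le> 2 * e"
proof -
  have "mom g 0 * r ^ (2 * ((n + 1) div 2)) \<le> mom g (2 * ((n + 1) div 2))"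
    by (rule mom_even_lower[OF g r(1,3) pos])
  also have "\<dots> = scal ((op ^^ (n mod 2)) g) ((op ^^ n) g)"
    unfolding scal_pow[OF g] by (rule arg_cong[of _ _ "mom g"]) presburger
  also have "\<dots> \<le> 2 * e"
    by (rule abs_scal_le_tv[OF op_pow_bdd[OF g] op_pow_bdd[OF g] op_pow_density(2)[OF g] tv])
  finally show ?thesis .
qed

end

section \<open>One-dimensional Gaussian potentials with a ripple\<close>

text \<open>Real and imaginary parts of the characteristic function of the standard normal
  law.\<close>

lemma std_normal_cos: "(\<integral>x. std_normal_density x * cos (t * x) \<partial>lborel) = exp (- t\<^sup>2 / 2)"
  and std_normal_sin: "(\<integral>x. std_normal_density x * sin (t * x) \<partial>lborel) = 0"
proof -
  have i: "complex_integrable lborel (\<lambda>x. std_normal_density x *\<^sub>R iexp (t * x))"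
    by (rule Bochner_Integration.integrable_bound[of _ "std_normal_density"])
      (auto simp: abs_mult)
  have "char std_normal_distribution t = (CLINT x|lborel. std_normal_density x *\<^sub>R iexp (t * x))"
    unfolding char_def by (subst integral_density) (auto simp: normal_density_nonneg)
  then have e: "(CLINT x|lborel. std_normal_density x *\<^sub>R iexp (t * x)) = complex_of_real (exp (- t\<^sup>2 / 2))"
    by (simp add: char_std_normal_distribution)
  show "(\<integral>x. std_normal_density x * cos (t * x) \<partial>lborel) = exp (- t\<^sup>2 / 2)"
    using integral_Re[OF i] unfolding e by (simp add: Re_exp)
  show "(\<integral>x. std_normal_density x * sin (t * x) \<partial>lborel) = 0"
    using integral_Im[OF i] unfolding e by (simp add: Im_exp)
qed

lemma integrable_normal_bounded:
  fixes f :: "real \<Rightarrow> real"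
  assumes [measurable]: "f \<in> borel_measurable borel" and "\<And>x. \<bar>f x\<bar> \<le> B" and \<sigma>: "\<sigma> > 0"
  shows "integrable lborel (\<lambda>x. normal_density \<mu> \<sigma> x * f x)"
proof (rule Bochner_Integration.integrable_bound[of _ "\<lambda>x. B * normal_density \<mu> \<sigma> x"])
  show "AE x in lborel. norm (normal_density \<mu> \<sigma> x * f x) \<le> norm (B * normal_density \<mu> \<sigma> x)"
    using order_trans[OF assms(2) abs_ge_self] by (auto simp: abs_mult mult.commute[of "\<bar>B\<bar>"] intro!: mult_left_mono)
qed (use \<sigma> in auto)

text \<open>Standardise and apply the addition formula; the sine term integrates to zero. The phase
  \<open>b\<close> is there for increments, where the cosine of a multiple of \<open>y - x\<close>
  is integrated over \<open>y\<close>.\<close>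

lemma normal_cos:
  assumes \<sigma>: "\<sigma> > 0"
  shows "(\<integral>x. normal_density \<mu> \<sigma> x * cos (t * x + b) \<partial>lborel) = exp (- (t * \<sigma>)\<^sup>2 / 2) * cos (t * \<mu> + b)"
proof -
  have "(\<integral>x. normal_density \<mu> \<sigma> x * cos (t * x + b) \<partial>lborel)
      = \<sigma> * (\<integral>x. normal_density \<mu> \<sigma> (\<mu> + \<sigma> * x) * cos (t * (\<mu> + \<sigma> * x) + b) \<partial>lborel)"
    using lborel_integral_real_affine[of \<sigma> "\<lambda>x. normal_density \<mu> \<sigma> x * cos (t * x + b)" \<mu>] \<sigma> by simp
  also have "\<dots> = (\<integral>x. \<sigma> * (normal_density \<mu> \<sigma> (\<mu> + \<sigma> * x) * cos (t * (\<mu> + \<sigma> * x) + b)) \<partial>lborel)" by simp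
  also have "\<dots> = (\<integral>x. cos (t * \<mu> + b) * (std_normal_density x * cos ((t * \<sigma>) * x)) - sin (t * \<mu> + b) * (std_normal_density x * sin ((t * \<sigma>) * x)) \<partial>lborel)"
  proof (intro Bochner_Integration.integral_cong refl)
    fix x
    have "\<sigma> * normal_density \<mu> \<sigma> (\<mu> + \<sigma> * x) = std_normal_density x"
      using \<sigma> by (simp add: normal_density_def power_mult_distrib real_sqrt_mult)
    moreover have "cos (t * (\<mu> + \<sigma> * x) + b) = cos (t * \<mu> + b) * cos ((t * \<sigma>) * x) - sin (t * \<mu> + b) * sin ((t * \<sigma>) * x)"
      by (simp add: cos_add[symmetric] algebra_simps)
    ultimately have "(\<sigma> * normal_density \<mu> \<sigma> (\<mu> + \<sigma> * x)) * cos (t * (\<mu> + \<sigma> * x) + b)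
      = std_normal_density x * (cos (t * \<mu> + b) * cos ((t * \<sigma>) * x) - sin (t * \<mu> + b) * sin ((t * \<sigma>) * x))"
      by (simp only:)
    then show "\<sigma> * (normal_density \<mu> \<sigma> (\<mu> + \<sigma> * x) * cos (t * (\<mu> + \<sigma> * x) + b))
      = cos (t * \<mu> + b) * (std_normal_density x * cos ((t * \<sigma>) * x)) - sin (t * \<mu> + b) * (std_normal_density x * sin ((t * \<sigma>) * x))"
      by (simp only: right_diff_distrib mult_ac)
  qed
  also have "\<dots> = cos (t * \<mu> + b) * exp (- (t * \<sigma>)\<^sup>2 / 2)"
    using integrable_normal_bounded[of "\<lambda>x. cos ((t * \<sigma>) * x)" 1 1 0] integrable_normal_bounded[of "\<lambda>x. sin ((t * \<sigma>) * x)" 1 1 0]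
    by (simp add: std_normal_cos std_normal_sin)
  finally show ?thesis by (simp add: mult.commute)
qed

text \<open>\<open>c x - c y\<close> has mean at least \<open>D\<close> under \<open>w\<close> and
  at most \<open>- D\<close> under the density with exchanged coordinates. This forces the two
  densities apart in Hellinger distance, which keeps their affinity away from 1.\<close>

lemma (in sigma_finite_measure) sqrt_affinity_le:
  fixes w :: "'a \<Rightarrow> 'a \<Rightarrow> real" and c :: "'a \<Rightarrow> real"
  assumes w [measurable]: "case_prod w \<in> borel_measurable (M \<Otimes>\<^sub>M M)" and nn: "\<And>x y. w x y \<ge> 0"
    and one: "(\<integral>\<^sup>+x. \<integral>\<^sup>+y. w x y \<partial>M \<partial>M) = 1"
    and c [measurable]: "c \<in> borel_measurable M" and c1: "\<And>x. \<bar>c x\<bar> \<le> 1"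
    and D: "0 \<le> D" "D \<le> (\<integral>(x, y). w x y * (c x - c y) \<partial>(M \<Otimes>\<^sub>M M))"
  shows "(\<integral>\<^sup>+x. \<integral>\<^sup>+y. sqrt (w x y * w y x) \<partial>M \<partial>M) \<le> ennreal (1 - D\<^sup>2 / 8)"
proof -
  interpret P: pair_sigma_finite M M ..
  let ?MM = "M \<Otimes>\<^sub>M M"
  let ?w = "\<lambda>(x, y). w x y" and ?v = "\<lambda>(x, y). w y x" and ?c = "\<lambda>(x, y). c x - c y"
  have one': "(\<integral>\<^sup>+z. ennreal (?w z) \<partial>?MM) = 1"
    using one by (subst nn_integral_fst[symmetric]) auto
  have iw: "integrable ?MM ?w"
    by (rule integrableI_bounded) (use one' nn in \<open>auto simp: case_prod_unfold\<close>)
  have iv: "integrable ?MM ?v" using P.integrable_product_swap[OF iw] by simp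
  have Iw: "integral\<^sup>L ?MM ?w = 1" using one' nn by (subst integral_eq_nn_integral) (auto simp: case_prod_unfold)
  have Iv: "integral\<^sup>L ?MM ?v = 1"
    using P.integral_product_swap[of ?w] Iw by (simp add: case_prod_unfold)
  have c2: "\<bar>?c z\<bar> \<le> 2" for z using c1[of "fst z"] c1[of "snd z"] by (auto simp: case_prod_unfold)
  have bnd: "integrable ?MM (\<lambda>z. f z * ?c z)" if f: "integrable ?MM f" for f :: "_ \<Rightarrow> real"
  proof (rule Bochner_Integration.integrable_bound[of _ "\<lambda>z. 2 * f z"])
    show "AE z in ?MM. norm (f z * ?c z) \<le> norm (2 * f z)"
      using c2 by (auto simp: abs_mult mult.commute[of 2] intro!: mult_left_mono simp del: split_paired_All)
  qed (use f in auto)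
  have swap: "(\<integral>z. ?v z * ?c z \<partial>?MM) = - (\<integral>z. ?w z * ?c z \<partial>?MM)"
  proof -
    have "(\<integral>z. ?w z * ?c z \<partial>?MM) = (\<integral>z. - (?v z * ?c z) \<partial>?MM)"
      by (subst P.integral_product_swap[symmetric])
        (auto simp: case_prod_unfold algebra_simps)
    then show ?thesis by simp
  qed
  let ?D = "\<integral>z. ?w z * ?c z \<partial>?MM"
  have DD: "D \<le> ?D" using D(2) by (simp add: case_prod_unfold)
  let ?s = "\<lambda>z. sqrt (?w z * ?v z)"
  \<comment> \<open>Cauchy-Schwarz written as one pointwise square. With a multiplier l in place of
    \<open>D/8\<close> the integrated bound is 1 - 2 l D + 8 l^2, least at l = D/8.\<close>
  have pw: "?s z \<le> (1/2 + (D/4)\<^sup>2) * (?w z + ?v z) - (D/8) * (?w z * ?c z - ?v z * ?c z)" for z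
  proof -
    define A B where "A = sqrt (?w z)" and "B = sqrt (?v z)"
    have AB: "?w z = A\<^sup>2" "?v z = B\<^sup>2" "?s z = A * B" "A \<ge> 0" "B \<ge> 0"
      using nn by (auto simp: A_def B_def real_sqrt_mult split: prod.split)
    \<comment> \<open>The cross term of this square is a multiple of A^2 - B^2, hence linear in the
      two densities.\<close>
    have "0 \<le> ((A - B) - (D/8) * ?c z * (A + B))\<^sup>2" by simp
    moreover have "(?c z * (A + B))\<^sup>2 \<le> 4 * (2 * (A\<^sup>2 + B\<^sup>2))"
    proof -
      have "(?c z)\<^sup>2 \<le> 4" using power_mono[OF c2[of z] abs_ge_zero, of 2] by simp
      moreover have "(A + B)\<^sup>2 \<le> 2 * (A\<^sup>2 + B\<^sup>2)" using zero_le_power2[of "A - B"] by (simp add: power2_eq_square algebra_simps)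
      ultimately show ?thesis unfolding power_mult_distrib by (intro mult_mono) auto
    qed
    from mult_left_mono[OF this, of "(D/8)\<^sup>2"]
    have "((D/8) * ?c z * (A + B))\<^sup>2 \<le> (D/8)\<^sup>2 * (8 * (A\<^sup>2 + B\<^sup>2))"
      by (simp only: power_mult_distrib mult_ac) simp
    ultimately have "2 * (A * B) \<le> A\<^sup>2 + B\<^sup>2 - 2 * (D/8) * ?c z * (A\<^sup>2 - B\<^sup>2) + (D/8)\<^sup>2 * (8 * (A\<^sup>2 + B\<^sup>2))"
    proof -
      define X where "X = (D/8) * ?c z * (A + B)"
      assume "0 \<le> ((A - B) - (D/8) * ?c z * (A + B))\<^sup>2"
        and "((D/8) * ?c z * (A + B))\<^sup>2 \<le> (D/8)\<^sup>2 * (8 * (A\<^sup>2 + B\<^sup>2))"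
      then have "0 \<le> (A - B)\<^sup>2 - 2 * (A - B) * X + X\<^sup>2" "X\<^sup>2 \<le> (D/8)\<^sup>2 * (8 * (A\<^sup>2 + B\<^sup>2))"
        unfolding X_def[symmetric] by (simp_all add: power2_diff)
      moreover have "(A - B) * X = (D/8) * ?c z * (A\<^sup>2 - B\<^sup>2)"
        unfolding X_def by (simp only: power2_eq_square square_diff_square_factored mult_ac)
      moreover have "(A - B)\<^sup>2 = A\<^sup>2 + B\<^sup>2 - 2 * (A * B)" by (simp add: power2_diff)
      ultimately show ?thesis by linarith
    qed
    then show ?thesis unfolding AB(3) unfolding AB(1,2) by (simp add: power2_eq_square field_simps)
  qed
  have rhs_int: "integrable ?MM (\<lambda>z. (1/2 + (D/4)\<^sup>2) * (?w z + ?v z) - (D/8) * (?w z * ?c z - ?v z * ?c z))"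
    by (intro Bochner_Integration.integrable_diff Bochner_Integration.integrable_add integrable_mult_right iw iv bnd)
  have s_nn: "?s z \<ge> 0" for z using nn by (auto split: prod.split)
  have "(\<integral>\<^sup>+x. \<integral>\<^sup>+y. sqrt (w x y * w y x) \<partial>M \<partial>M) = (\<integral>\<^sup>+z. ennreal (?s z) \<partial>?MM)"
    by (subst nn_integral_fst[symmetric]) auto
  also have "\<dots> \<le> (\<integral>\<^sup>+z. ennreal ((1/2 + (D/4)\<^sup>2) * (?w z + ?v z) - (D/8) * (?w z * ?c z - ?v z * ?c z)) \<partial>?MM)"
    by (intro nn_integral_mono ennreal_leI pw)
  also have "\<dots> = ennreal (\<integral>z. (1/2 + (D/4)\<^sup>2) * (?w z + ?v z) - (D/8) * (?w z * ?c z - ?v z * ?c z) \<partial>?MM)"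
    using order_trans[OF s_nn pw] by (intro nn_integral_eq_integral rhs_int) auto
  also have "(\<integral>z. (1/2 + (D/4)\<^sup>2) * (?w z + ?v z) - (D/8) * (?w z * ?c z - ?v z * ?c z) \<partial>?MM)
     = (1/2 + (D/4)\<^sup>2) * (integral\<^sup>L ?MM ?w + integral\<^sup>L ?MM ?v) - (D/8) * (?D - (\<integral>z. ?v z * ?c z \<partial>?MM))"
    using iw iv bnd[OF iw] bnd[OF iv] by (simp only: Bochner_Integration.integral_diff Bochner_Integration.integral_add integral_mult_right_zero
        Bochner_Integration.integrable_diff Bochner_Integration.integrable_add integrable_mult_right)
  also have "\<dots> = 1 + 2 * (D/4)\<^sup>2 - (D/4) * ?D"
    unfolding swap Iw Iv by (simp add: algebra_simps)
  also have "ennreal \<dots> \<le> ennreal (1 - D\<^sup>2 / 8)"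
    using mult_left_mono[OF DD, of "D / 4"] D(1) by (intro ennreal_leI) (simp add: power2_eq_square)
  finally show ?thesis .
qed

section \<open>The rippled Gaussian density on the line\<close>

locale ripple =
  fixes a dl w :: real
  assumes a_pos: "a > 0" and dl_nonneg: "dl \<ge> 0"
begin

text \<open>With \<open>dl = 0\<close> this is the Gaussian potential of curvature \<open>a\<close>,
  and \<open>w\<close> survives as the frequency of the test function \<open>cos (w * x)\<close>; so
  one locale serves every target.\<close>

definition pot :: "real \<Rightarrow> real" where "pot x = a * x\<^sup>2 / 2 - dl * cos (w * x)"
definition dpot :: "real \<Rightarrow> real" where "dpot x = a * x + dl * w * sin (w * x)"
definition gauss :: "real \<Rightarrow> real" where "gauss = normal_density 0 (1 / sqrt a)"
definition Z :: real where "Z = (\<integral>x. exp (- pot x) \<partial>lborel)"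
definition dens :: "real \<Rightarrow> real" where "dens x = exp (- pot x) / Z"

lemma pot_measurable [measurable]: "pot \<in> borel_measurable borel" unfolding pot_def by measurable
lemma dpot_measurable [measurable]: "dpot \<in> borel_measurable borel" unfolding dpot_def by measurable
lemma gauss_measurable [measurable]: "gauss \<in> borel_measurable borel" unfolding gauss_def by measurable
lemma dens_measurable [measurable]: "dens \<in> borel_measurable borel" unfolding dens_def by measurable

text \<open>A Gaussian reweighted by a factor between \<open>exp (- dl)\<close> and
  \<open>exp dl\<close>, so that expectations can be compared with Gaussian ones.\<close>

lemma exp_pot: "exp (- pot x) = sqrt (2 * pi / a) * (gauss x * exp (dl * cos (w * x)))"
proof -
  have "sqrt (2 * pi / a) * gauss x = exp (- (a * x\<^sup>2 / 2))"
    using a_pos unfolding gauss_def normal_density_def by (simp add: power_divide field_simps real_sqrt_divide real_sqrt_mult)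
  then show ?thesis by (simp add: pot_def flip: mult.assoc exp_add)
qed

lemma gauss_nonneg: "gauss x \<ge> 0" unfolding gauss_def by simp

lemma exp_cos_bounds: "exp (- dl) \<le> exp (dl * cos (w * x))" "exp (dl * cos (w * x)) \<le> exp dl"
  using dl_nonneg mult_left_mono[OF cos_ge_minus_one[of "w * x"] dl_nonneg] mult_left_mono[OF cos_le_one[of "w * x"] dl_nonneg] by auto

lemma gauss_integrable:
  fixes f :: "real \<Rightarrow> real"
  assumes [measurable]: "f \<in> borel_measurable borel" and "\<And>x. \<bar>f x\<bar> \<le> B"
  shows "integrable lborel (\<lambda>x. gauss x * f x)"
  unfolding gauss_def by (rule integrable_normal_bounded[OF assms]) (use a_pos in simp)

lemma gauss_cos: "(\<integral>x. gauss x * cos (t * x) \<partial>lborel) = exp (- t\<^sup>2 / (2 * a))"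
  unfolding gauss_def using a_pos normal_cos[of "1 / sqrt a" 0 t 0] by (simp add: power_divide)

lemma gauss_one: "(\<integral>x. gauss x \<partial>lborel) = 1"
  unfolding gauss_def using a_pos by simp

lemma pot_integral: "(\<integral>x. exp (- pot x) * f x \<partial>lborel) = sqrt (2 * pi / a) * (\<integral>x. gauss x * (exp (dl * cos (w * x)) * f x) \<partial>lborel)"
  unfolding exp_pot by (simp add: mult.assoc)

lemma Z_le: "Z \<le> sqrt (2 * pi / a) * exp dl" and Z_ge: "sqrt (2 * pi / a) * exp (- dl) \<le> Z"
proof -
  have i: "integrable lborel (\<lambda>x. gauss x * exp (dl * cos (w * x)))"
    using exp_cos_bounds by (intro gauss_integrable[of _ "exp dl"]) auto
  have j: "integrable lborel (\<lambda>x. gauss x * c)" for c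
    by (intro gauss_integrable[of _ "\<bar>c\<bar>"]) auto
  have e: "Z = sqrt (2 * pi / a) * (\<integral>x. gauss x * exp (dl * cos (w * x)) \<partial>lborel)"
    unfolding Z_def using pot_integral[of "\<lambda>_. 1"] by simp
  have "(\<integral>x. gauss x * exp (dl * cos (w * x)) \<partial>lborel) \<le> (\<integral>x. gauss x * exp dl \<partial>lborel)"
    by (intro integral_mono i j mult_left_mono exp_cos_bounds gauss_nonneg)
  then show "Z \<le> sqrt (2 * pi / a) * exp dl"
    unfolding e using a_pos by (intro mult_left_mono) (auto simp: gauss_one)
  have "(\<integral>x. gauss x * exp (- dl) \<partial>lborel) \<le> (\<integral>x. gauss x * exp (dl * cos (w * x)) \<partial>lborel)"
    by (intro integral_mono i j mult_left_mono exp_cos_bounds gauss_nonneg)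
  then show "sqrt (2 * pi / a) * exp (- dl) \<le> Z"
    unfolding e using a_pos by (intro mult_left_mono) (auto simp: gauss_one)
qed

lemma Z_pos: "Z > 0"
  by (rule less_le_trans[OF _ Z_ge]) (use a_pos in simp)

lemma dens_pos: "dens x > 0" and dens_nonneg: "dens x \<ge> 0"
  unfolding dens_def using Z_pos by (auto intro: less_imp_le)

lemma dens_integrable:
  fixes f :: "real \<Rightarrow> real"
  assumes [measurable]: "f \<in> borel_measurable borel" and b: "\<And>x. \<bar>f x\<bar> \<le> B"
  shows "integrable lborel (\<lambda>x. dens x * f x)"
proof -
  have "integrable lborel (\<lambda>x. gauss x * (exp (dl * cos (w * x)) * f x))"
    using exp_cos_bounds b by (intro gauss_integrable[of _ "exp dl * B"]) (auto simp: abs_mult intro!: mult_mono)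
  then have "integrable lborel (\<lambda>x. (sqrt (2 * pi / a) / Z) * (gauss x * (exp (dl * cos (w * x)) * f x)))"
    by (rule integrable_mult_right)
  then show ?thesis unfolding dens_def exp_pot by (simp add: mult_ac)
qed

lemma dens_one: "(\<integral>x. dens x \<partial>lborel) = 1"
  unfolding dens_def using Z_pos by (simp add: Z_def[symmetric])

lemma nn_dens_one: "(\<integral>\<^sup>+x. dens x \<partial>lborel) = 1"
  using nn_integral_eq_integral[of lborel dens] dens_integrable[of "\<lambda>_. 1" 1] dens_nonneg by (simp add: dens_one)

text \<open>The weighted integrand is bounded below by \<open>g\<close> and the normalisation by its
  extreme value, at the cost of \<open>exp (- dl)\<close>. Nonnegativity of the Gaussian integral
  allows the two bounds to be multiplied.\<close>

lemma dens_lower: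
  assumes [measurable]: "f \<in> borel_measurable borel" and b: "\<And>x. \<bar>f x\<bar> \<le> B"
    and g: "integrable lborel (\<lambda>x. gauss x * g x)" "\<And>x. g x \<le> exp (dl * cos (w * x)) * f x"
    and nn: "0 \<le> (\<integral>x. gauss x * g x \<partial>lborel)"
  shows "exp (- dl) * (\<integral>x. gauss x * g x \<partial>lborel) \<le> (\<integral>x. dens x * f x \<partial>lborel)"
proof -
  have "integrable lborel (\<lambda>x. gauss x * (exp (dl * cos (w * x)) * f x))"
    using exp_cos_bounds b by (intro gauss_integrable[of _ "exp dl * B"]) (auto simp: abs_mult intro!: mult_mono)
  then have "(\<integral>x. gauss x * g x \<partial>lborel) \<le> (\<integral>x. gauss x * (exp (dl * cos (w * x)) * f x) \<partial>lborel)"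
    by (intro integral_mono g mult_left_mono gauss_nonneg)
  moreover have "exp (- dl) \<le> sqrt (2 * pi / a) / Z"
    using Z_le Z_pos by (simp add: exp_minus field_simps)
  ultimately have "exp (- dl) * (\<integral>x. gauss x * g x \<partial>lborel) \<le> sqrt (2 * pi / a) / Z * (\<integral>x. gauss x * (exp (dl * cos (w * x)) * f x) \<partial>lborel)"
    using nn a_pos Z_pos by (intro mult_mono) auto
  also have "\<dots> = (\<integral>x. exp (- pot x) * f x \<partial>lborel) / Z"
    unfolding pot_integral by simp
  also have "\<dots> = (\<integral>x. dens x * f x \<partial>lborel)" unfolding dens_def by simp
  finally show ?thesis .
qed

text \<open>For c \<ge> 0 this is 1 + x \<le> exp x; for c < 0 it is the chord of exp over [-s, 0],
  multiplied by a negative number. The term in c^2 is the gain: for small s its mean is of order s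
  even where the mean of c is negligible.\<close>

lemma exp_tilt: "c + (1 - exp (- s)) * c\<^sup>2 \<le> exp (s * c) * c" if c: "\<bar>c\<bar> \<le> 1" and s: "s \<ge> 0" for c s :: real
proof (cases "c \<ge> 0")
  case True
  have "1 - exp (- s) \<le> s" using exp_ge_add_one_self[of "-s"] by simp
  then have "1 + (1 - exp (- s)) * c \<le> 1 + s * c" using True by (simp add: mult_right_mono)
  also have "\<dots> \<le> exp (s * c)" by (rule exp_ge_add_one_self)
  finally have "(1 + (1 - exp (- s)) * c) * c \<le> exp (s * c) * c" using True by (rule mult_right_mono)
  then show ?thesis by (simp add: power2_eq_square algebra_simps)
next
  case False
  have "exp (s * c) = exp ((1 - (-c)) *\<^sub>R 0 + (-c) *\<^sub>R (-s))" by (simp add: mult.commute)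
  also have "\<dots> \<le> (1 - (-c)) * exp 0 + (-c) * exp (-s)"
    using convex_onD[OF exp_convex, of "-c" 0 "-s"] c False by simp
  finally have "exp (s * c) \<le> 1 + (1 - exp (- s)) * c" by (simp add: algebra_simps)
  then have "(1 + (1 - exp (- s)) * c) * c \<le> exp (s * c) * c" using False by (intro mult_right_mono_neg) auto
  then show ?thesis by (simp add: power2_eq_square algebra_simps)
qed

text \<open>The first summand is the Gaussian mean of the cosine. The second is the tilt term, in
  which the squared cosine has Gaussian mean at least 1/2; it remains when \<open>w\<close> is so
  large that the first is negligible.\<close>

lemma dens_cos_lower:
  "exp (- dl) * (exp (- w\<^sup>2 / (2 * a)) + (1 - exp (- dl)) / 2) \<le> (\<integral>x. dens x * cos (w * x) \<partial>lborel)"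
proof -
  let ?g = "\<lambda>x. cos (w * x) + (1 - exp (- dl)) * (cos (w * x))\<^sup>2"
  have c: "1 - exp (- dl) \<ge> 0" using dl_nonneg by simp
  have i1: "integrable lborel (\<lambda>x. gauss x * cos (t * x))" for t
    by (rule gauss_integrable[of _ 1]) auto
  have i0: "integrable lborel gauss" using i1[of 0] by simp
  have e: "gauss x * ?g x = gauss x * cos (w * x) + (1 - exp (- dl)) / 2 * (gauss x + gauss x * cos ((2 * w) * x))" for x
  proof -
    have "cos ((2 * w) * x) = 2 * (cos (w * x))\<^sup>2 - 1" using cos_double_cos[of "w * x"] by (simp add: mult.assoc)
    then show ?thesis by (simp only:) (simp add: field_simps)
  qed
  have ig: "integrable lborel (\<lambda>x. gauss x * ?g x)"
    unfolding e by (intro Bochner_Integration.integrable_add integrable_mult_right i1 i0)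
  have I: "(\<integral>x. gauss x * ?g x \<partial>lborel) = exp (- w\<^sup>2 / (2 * a)) + (1 - exp (- dl)) / 2 * (1 + exp (- (2 * w)\<^sup>2 / (2 * a)))"
    unfolding e using i1[of w] i1[of "2 * w"] i0 by (simp add: gauss_cos gauss_one)
  have lo: "exp (- w\<^sup>2 / (2 * a)) + (1 - exp (- dl)) / 2 \<le> (\<integral>x. gauss x * ?g x \<partial>lborel)"
    unfolding I using c by (simp add: algebra_simps)
  have "exp (- dl) * (exp (- w\<^sup>2 / (2 * a)) + (1 - exp (- dl)) / 2) \<le> exp (- dl) * (\<integral>x. gauss x * ?g x \<partial>lborel)"
    using lo by (intro mult_left_mono) auto
  also have "\<dots> \<le> (\<integral>x. dens x * cos (w * x) \<partial>lborel)"
  proof (rule dens_lower[OF _ _ ig])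
    show "?g x \<le> exp (dl * cos (w * x)) * cos (w * x)" for x
      by (rule exp_tilt) (use dl_nonneg in auto)
    show "0 \<le> (\<integral>x. gauss x * ?g x \<partial>lborel)" by (rule order_trans[OF _ lo]) (use c in simp)
    show "\<bar>cos (w * x)\<bar> \<le> 1" for x by simp
  qed auto
  finally show ?thesis .
qed

text \<open>The frequency \<open>sqrt a\<close> is the reciprocal of the Gaussian standard
  deviation, so the bound is free of \<open>a\<close>. One factor \<open>exp (- dl)\<close> is the
  smallest ripple weight, the other comes from the normalisation.\<close>

lemma dens_sin2_lower:
  "exp (- 2 * dl) * ((1 - exp (- 2)) / 2) \<le> (\<integral>x. dens x * (sin (sqrt a * x))\<^sup>2 \<partial>lborel)"
proof -
  let ?g = "\<lambda>x. exp (- dl) * (sin (sqrt a * x))\<^sup>2"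
  have i1: "integrable lborel (\<lambda>x. gauss x * cos (t * x))" for t
    by (rule gauss_integrable[of _ 1]) auto
  have i0: "integrable lborel gauss" using i1[of 0] by simp
  have e: "gauss x * ?g x = exp (- dl) / 2 * (gauss x - gauss x * cos ((2 * sqrt a) * x))" for x
  proof -
    have "cos ((2 * sqrt a) * x) = 1 - 2 * (sin (sqrt a * x))\<^sup>2" using cos_double_sin[of "sqrt a * x"] by (simp add: mult.assoc)
    then show ?thesis by (simp only:) (simp add: algebra_simps)
  qed
  have ig: "integrable lborel (\<lambda>x. gauss x * ?g x)"
    unfolding e by (intro Bochner_Integration.integrable_diff integrable_mult_right i1 i0)
  have I: "(\<integral>x. gauss x * ?g x \<partial>lborel) = exp (- dl) / 2 * (1 - exp (- 2))"
    unfolding e using i1[of "2 * sqrt a"] i0 a_pos by (simp add: gauss_cos gauss_one power_mult_distrib)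
  have "exp (- 2 * dl) * ((1 - exp (- 2)) / 2) = exp (- dl) * (\<integral>x. gauss x * ?g x \<partial>lborel)"
    unfolding I by (simp flip: exp_add)
  also have "\<dots> \<le> (\<integral>x. dens x * (sin (sqrt a * x))\<^sup>2 \<partial>lborel)"
  proof (rule dens_lower[OF _ _ ig])
    show "?g x \<le> exp (dl * cos (w * x)) * (sin (sqrt a * x))\<^sup>2" for x
      by (intro mult_right_mono exp_cos_bounds) auto
    show "0 \<le> (\<integral>x. gauss x * ?g x \<partial>lborel)" unfolding I by simp
    show "\<bar>(sin (sqrt a * x))\<^sup>2\<bar> \<le> 1" for x by (simp add: abs_square_le_1)
  qed auto
  finally show ?thesis .
qed

lemma dens_sin: "(\<integral>x. dens x * sin (sqrt a * x) \<partial>lborel) = 0"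
proof -
  have e: "dens (- x) = dens x" for x unfolding dens_def pot_def by simp
  have "(\<integral>x. dens x * sin (sqrt a * x) \<partial>lborel) = - (\<integral>x. dens x * sin (sqrt a * x) \<partial>lborel)"
    using lborel_integral_real_affine[of "-1" "\<lambda>x. dens x * sin (sqrt a * x)" 0] by (simp add: e)
  then show ?thesis by simp
qed

lemma nn_dens_sin: "(\<integral>\<^sup>+x. ennreal (dens x * (1 + sin (sqrt a * x))) \<partial>lborel) = 1"
proof -
  have i: "integrable lborel (\<lambda>x. dens x * sin (sqrt a * x))" "integrable lborel dens"
    using dens_integrable[of "\<lambda>x. sin (sqrt a * x)" 1] dens_integrable[of "\<lambda>x. 1" 1] by auto
  have s: "1 + sin (sqrt a * x) \<ge> 0" for x using sin_ge_minus_one[of "sqrt a * x"] by linarith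
  have e: "dens x * (1 + sin (sqrt a * x)) = dens x + dens x * sin (sqrt a * x)" for x by (simp add: distrib_left)
  have "(\<integral>\<^sup>+x. ennreal (dens x * (1 + sin (sqrt a * x))) \<partial>lborel) = ennreal (\<integral>x. dens x * (1 + sin (sqrt a * x)) \<partial>lborel)"
  proof (intro nn_integral_eq_integral AE_I2 mult_nonneg_nonneg dens_nonneg s)
    show "integrable lborel (\<lambda>x. dens x * (1 + sin (sqrt a * x)))" unfolding e using i by simp
  qed
  also have "(\<integral>x. dens x * (1 + sin (sqrt a * x)) \<partial>lborel) = (\<integral>x. dens x + dens x * sin (sqrt a * x) \<partial>lborel)"
    by (simp only: e)
  also have "\<dots> = 1" using i by (simp add: dens_one dens_sin)
  finally show ?thesis by simp
qed

section \<open>Joint law of the current state and the proposal\<close>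

definition prop1 :: "real \<Rightarrow> real \<Rightarrow> real \<Rightarrow> real" where
  "prop1 h x = normal_density (x - h * dpot x) (sqrt (2 * h))"

lemma prop1_measurable [measurable]: "(\<lambda>(x, y). prop1 h x y) \<in> borel_measurable (borel \<Otimes>\<^sub>M borel)"
  unfolding prop1_def normal_density_def by measurable

lemma prop1_nonneg: "prop1 h x y \<ge> 0" unfolding prop1_def by simp

lemma nn_prop1: "h > 0 \<Longrightarrow> (\<integral>\<^sup>+y. prop1 h x y \<partial>lborel) = 1"
  unfolding prop1_def by (subst nn_integral_eq_integral) auto

lemma joint_one: "h > 0 \<Longrightarrow> (\<integral>\<^sup>+x. \<integral>\<^sup>+y. ennreal (dens x * prop1 h x y) \<partial>lborel \<partial>lborel) = 1"
  by (simp add: ennreal_mult dens_nonneg prop1_nonneg nn_integral_cmult nn_prop1 nn_dens_one)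

lemma joint_integrable:
  fixes f :: "real \<times> real \<Rightarrow> real"
  assumes h: "h > 0" and [measurable]: "f \<in> borel_measurable (borel \<Otimes>\<^sub>M borel)" and b: "\<And>z. \<bar>f z\<bar> \<le> B"
  shows "integrable (lborel \<Otimes>\<^sub>M lborel) (\<lambda>(x, y). dens x * prop1 h x y * f (x, y))"
proof (rule Bochner_Integration.integrable_bound[of _ "\<lambda>(x, y). B * (dens x * prop1 h x y)"])
  have "(\<integral>\<^sup>+z. ennreal (case z of (x, y) \<Rightarrow> dens x * prop1 h x y) \<partial>(lborel \<Otimes>\<^sub>M lborel)) = 1"
    using joint_one[OF h] by (subst lborel.nn_integral_fst[symmetric]) auto
  then have "integrable (lborel \<Otimes>\<^sub>M lborel) (\<lambda>(x, y). dens x * prop1 h x y)"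
    by (intro integrableI_bounded) (auto simp: case_prod_unfold dens_nonneg prop1_nonneg abs_mult)
  from integrable_mult_right[OF this, of B]
  show "integrable (lborel \<Otimes>\<^sub>M lborel) (\<lambda>(x, y). B * (dens x * prop1 h x y))"
    by (simp add: case_prod_unfold)
  show "AE z in lborel \<Otimes>\<^sub>M lborel. norm (case z of (x, y) \<Rightarrow> dens x * prop1 h x y * f (x, y))
     \<le> norm (case z of (x, y) \<Rightarrow> B * (dens x * prop1 h x y))"
    using b by (intro AE_I2) (auto simp: abs_mult mult.commute[of "\<bar>B\<bar>"] intro!: mult_left_mono order_trans[OF b abs_ge_self])
qed measurable

text \<open>Given \<open>x\<close>, the noise of variance \<open>2 * h\<close> makes the mean of
  \<open>cos (w * y)\<close> equal to \<open>exp (- w\<^sup>2 * h)\<close> times a cosine, whatever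
  the drift, and that cosine is at most 1.\<close>

lemma joint_defect:
  assumes h: "h > 0"
  shows "(\<integral>x. dens x * cos (w * x) \<partial>lborel) - exp (- w\<^sup>2 * h)
    \<le> (\<integral>(x, y). dens x * prop1 h x y * (cos (w * x) - cos (w * y)) \<partial>(lborel \<Otimes>\<^sub>M lborel))"
proof -
  have int: "integrable (lborel \<Otimes>\<^sub>M lborel) (\<lambda>(x, y). dens x * prop1 h x y * (cos (w * x) - cos (w * y)))"
  proof -
    have "\<bar>cos (w * x) - cos (w * y)\<bar> \<le> 2" for x y
      using abs_triangle_ineq4[of "cos (w * x)" "cos (w * y)"] abs_cos_le_one[of "w * x"] abs_cos_le_one[of "w * y"] by linarith
    then show ?thesis using joint_integrable[OF h, of "\<lambda>(x, y). cos (w * x) - cos (w * y)" 2] by (simp add: case_prod_unfold)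
  qed
  have inner: "(\<integral>y. dens x * prop1 h x y * (cos (w * x) - cos (w * y)) \<partial>lborel)
     = dens x * (cos (w * x) - exp (- w\<^sup>2 * h) * cos (w * (x - h * dpot x)))" for x
  proof -
    have "(\<integral>y. dens x * prop1 h x y * (cos (w * x) - cos (w * y)) \<partial>lborel)
      = (\<integral>y. dens x * (cos (w * x) * prop1 h x y - prop1 h x y * cos (w * y)) \<partial>lborel)"
      by (intro Bochner_Integration.integral_cong) (auto simp: algebra_simps)
    also have "\<dots> = dens x * (cos (w * x) - exp (- (w * sqrt (2 * h))\<^sup>2 / 2) * cos (w * (x - h * dpot x)))"
      using h integrable_normal_bounded[of "\<lambda>y. cos (w * y)" 1 "sqrt (2 * h)" "x - h * dpot x"]
        normal_cos[of "sqrt (2 * h)" "x - h * dpot x" w 0]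
      by (simp add: prop1_def)
    finally show ?thesis using h by (simp add: power_mult_distrib)
  qed
  have i1: "integrable lborel (\<lambda>x. dens x * cos (w * x))" by (rule dens_integrable[of _ 1]) auto
  have i2: "integrable lborel (\<lambda>x. dens x * (cos (w * x) - exp (- w\<^sup>2 * h) * cos (w * (x - h * dpot x))))"
    using lborel_pair.integrable_fst'[OF int] by (simp add: inner)
  have i0: "integrable lborel dens" using dens_integrable[of "\<lambda>_. 1" 1] by simp
  have "(\<integral>x. dens x * cos (w * x) \<partial>lborel) - exp (- w\<^sup>2 * h) = (\<integral>x. dens x * cos (w * x) - exp (- w\<^sup>2 * h) * dens x \<partial>lborel)"
    using i1 i0 by (simp add: dens_one)
  also have "\<dots> \<le> (\<integral>x. dens x * (cos (w * x) - exp (- w\<^sup>2 * h) * cos (w * (x - h * dpot x))) \<partial>lborel)"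
  proof (intro integral_mono i2 Bochner_Integration.integrable_diff i1 integrable_mult_right i0)
    fix x
    have "exp (- w\<^sup>2 * h) * cos (w * (x - h * dpot x)) \<le> exp (- w\<^sup>2 * h) * 1" by (intro mult_left_mono) auto
    then have "dens x * (cos (w * x) - exp (- w\<^sup>2 * h)) \<le> dens x * (cos (w * x) - exp (- w\<^sup>2 * h) * cos (w * (x - h * dpot x)))"
      using dens_nonneg by (intro mult_left_mono) auto
    then show "dens x * cos (w * x) - exp (- w\<^sup>2 * h) * dens x \<le> dens x * (cos (w * x) - exp (- w\<^sup>2 * h) * cos (w * (x - h * dpot x)))"
      by (simp add: algebra_simps)
  qed
  also have "\<dots> = (\<integral>(x, y). dens x * prop1 h x y * (cos (w * x) - cos (w * y)) \<partial>(lborel \<Otimes>\<^sub>M lborel))"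
    using lborel_pair.integral_fst'[OF int] by (simp add: inner)
  finally show ?thesis .
qed

lemma affinity_le:
  assumes h: "h > 0" and D: "0 \<le> D" "D \<le> exp (- dl) * (exp (- w\<^sup>2 / (2 * a)) + (1 - exp (- dl)) / 2) - exp (- w\<^sup>2 * h)"
  shows "(\<integral>\<^sup>+x. \<integral>\<^sup>+y. sqrt ((dens x * prop1 h x y) * (dens y * prop1 h y x)) \<partial>lborel \<partial>lborel) \<le> ennreal (1 - D\<^sup>2 / 8)"
proof (rule lborel.sqrt_affinity_le[where w="\<lambda>x y. dens x * prop1 h x y" and c="\<lambda>x. cos (w * x)"])
  show "D \<le> (\<integral>(x, y). dens x * prop1 h x y * (cos (w * x) - cos (w * y)) \<partial>(lborel \<Otimes>\<^sub>M lborel))"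
    using D(2) dens_cos_lower joint_defect[OF h] by linarith
qed (use D(1) joint_one[OF h] in \<open>auto simp: dens_nonneg prop1_nonneg\<close>)

text \<open>Given \<open>x\<close>, the increment is normal with mean \<open>- h * a * x\<close> and
  variance \<open>2 * h\<close>. The noise gives the factor \<open>exp (- (a * h))\<close>;
  averaging the drift over the Gaussian gives \<open>exp (- (a * h)\<^sup>2 / 2)\<close>.\<close>

lemma joint_increment:
  assumes h: "h > 0" and dl: "dl = 0"
  shows "(\<integral>\<^sup>+x. \<integral>\<^sup>+y. ennreal (dens x * prop1 h x y * (1 - cos (sqrt a * (x - y)))) \<partial>lborel \<partial>lborel)
     = ennreal (1 - exp (- (a * h) - (a * h)\<^sup>2 / 2))"
proof -
  have dg: "dens = gauss"
  proof
    fix x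
    have "Z = sqrt (2 * pi / a)" using Z_le Z_ge dl by simp
    then show "dens x = gauss x" unfolding dens_def exp_pot using dl a_pos by simp
  qed
  let ?F = "\<lambda>x. 1 - exp (- (a * h)) * cos ((sqrt a * (a * h)) * x)"
  have F: "?F x \<ge> 0" for x
  proof -
    have "exp (- (a * h)) * cos ((sqrt a * (a * h)) * x) \<le> exp (- (a * h)) * 1"
      by (intro mult_left_mono) auto
    moreover have "exp (- (a * h)) \<le> 1" using h a_pos by simp
    ultimately show ?thesis by linarith
  qed
  have dpot: "dpot x = a * x" for x using dl unfolding dpot_def by simp
  have inner: "(\<integral>\<^sup>+y. ennreal (dens x * prop1 h x y * (1 - cos (sqrt a * (x - y)))) \<partial>lborel)
     = ennreal (gauss x * ?F x)" for x
  proof -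
    let ?c = "\<lambda>y. cos (sqrt a * y + - sqrt a * x)"
    have c: "cos (sqrt a * (x - y)) = ?c y" for y
      by (subst cos_minus[symmetric]) (simp add: algebra_simps)
    have i: "integrable lborel (\<lambda>y. prop1 h x y * ?c y)" "integrable lborel (prop1 h x)"
      unfolding prop1_def using h integrable_normal_bounded[of ?c 1 "sqrt (2 * h)" "x - h * dpot x"] by auto
    have "(\<integral>\<^sup>+y. ennreal (dens x * prop1 h x y * (1 - cos (sqrt a * (x - y)))) \<partial>lborel)
      = ennreal (\<integral>y. dens x * (prop1 h x y - prop1 h x y * ?c y) \<partial>lborel)"
    proof (subst nn_integral_eq_integral[symmetric])
      have e: "dens x * prop1 h x y * (1 - ?c y) = dens x * (prop1 h x y - prop1 h x y * ?c y)" for y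
        by (simp add: algebra_simps)
      have "0 \<le> dens x * prop1 h x y * (1 - ?c y)" for y
        using dens_nonneg prop1_nonneg by (intro mult_nonneg_nonneg) auto
      then show "AE y in lborel. 0 \<le> dens x * (prop1 h x y - prop1 h x y * ?c y)"
        by (simp only: e) simp
      show "(\<integral>\<^sup>+y. ennreal (dens x * prop1 h x y * (1 - cos (sqrt a * (x - y)))) \<partial>lborel)
        = (\<integral>\<^sup>+y. ennreal (dens x * (prop1 h x y - prop1 h x y * ?c y)) \<partial>lborel)"
        by (simp only: c e)
    qed (use i in simp)
    also have "\<dots> = ennreal (dens x * (1 - exp (- (sqrt a * sqrt (2 * h))\<^sup>2 / 2) * cos (sqrt a * (x - h * dpot x) + - sqrt a * x)))"
      using i h normal_cos[of "sqrt (2 * h)" "x - h * dpot x" "sqrt a" "- sqrt a * x"] by (simp add: prop1_def)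
    also have "cos (sqrt a * (x - h * dpot x) + - sqrt a * x) = cos ((sqrt a * (a * h)) * x)"
      unfolding dpot by (subst cos_minus[symmetric]) (simp add: algebra_simps)
    also have "- (sqrt a * sqrt (2 * h))\<^sup>2 / 2 = - (a * h)" using a_pos h by (simp add: power_mult_distrib)
    finally show ?thesis using a_pos h by (simp add: dg power_mult_distrib)
  qed
  have i: "integrable lborel (\<lambda>x. gauss x * cos ((sqrt a * (a * h)) * x))" "integrable lborel gauss"
    using gauss_integrable[of "\<lambda>x. cos ((sqrt a * (a * h)) * x)" 1] gauss_integrable[of "\<lambda>x. 1" 1] by auto
  have e: "gauss x * ?F x = gauss x - exp (- (a * h)) * (gauss x * cos ((sqrt a * (a * h)) * x))" for x
    by (simp add: algebra_simps)
  have "(\<integral>\<^sup>+x. ennreal (gauss x * ?F x) \<partial>lborel) = ennreal (\<integral>x. gauss x * ?F x \<partial>lborel)"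
  proof (intro nn_integral_eq_integral AE_I2 mult_nonneg_nonneg gauss_nonneg F)
    show "integrable lborel (\<lambda>x. gauss x * ?F x)" unfolding e using i by simp
  qed
  also have "(\<integral>x. gauss x * ?F x \<partial>lborel) = 1 - exp (- (a * h)) * exp (- (sqrt a * (a * h))\<^sup>2 / (2 * a))"
    unfolding e using i by (simp add: gauss_one gauss_cos)
  also have "\<dots> = 1 - exp (- (a * h) - (a * h)\<^sup>2 / 2)"
    using a_pos by (simp add: power_mult_distrib flip: exp_add)
  finally show ?thesis unfolding inner .
qed

end

section \<open>Separable targets\<close>

lemma taylor2_bound:
  fixes f :: "real \<Rightarrow> real"
  assumes f: "\<And>t. (f has_real_derivative f' t) (at t)" and f': "\<And>t. (f' has_real_derivative f'' t) (at t)"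
    and K: "\<And>t. \<bar>f'' t\<bar> \<le> K"
  shows "\<bar>f y - f x - f' x * (y - x)\<bar> \<le> K / 2 * (y - x)\<^sup>2"
proof (cases "x = y")
  case False
  define diff where "diff m = (if m = 0 then f else if m = 1 then f' else f'')" for m :: nat
  have "\<exists>t. (if y < x then y < t \<and> t < x else x < t \<and> t < y) \<and>
      f y = (\<Sum>m<2. diff m x / fact m * (y - x) ^ m) + diff 2 t / fact 2 * (y - x) ^ 2"
    by (rule Taylor[of 2 diff f "min x y" "max x y"])
      (use f f' False in \<open>auto simp: diff_def less_2_cases_iff\<close>)
  then obtain t where "f y = f x + f' x * (y - x) + f'' t / 2 * (y - x)\<^sup>2"
    by (auto simp: diff_def numeral_2_eq_2)
  then have "\<bar>f y - f x - f' x * (y - x)\<bar> = \<bar>f'' t\<bar> / 2 * (y - x)\<^sup>2" by (simp add: abs_mult)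
  also have "\<dots> \<le> K / 2 * (y - x)\<^sup>2" using K[of t] by (intro mult_right_mono) auto
  finally show ?thesis .
qed simp

section \<open>Coordinate norms and uniqueness of gradients\<close>

lemma norm_d_sq: "(norm_d d v)\<^sup>2 = (\<Sum>i<d. (v i)\<^sup>2)"
  unfolding norm_d_def inner_d_def power2_eq_square[symmetric] by (simp add: sum_nonneg)

lemma norm_d_nonneg: "norm_d d v \<ge> 0"
  unfolding norm_d_def inner_d_def power2_eq_square[symmetric] by (simp add: sum_nonneg)

text \<open>\<open>grad_d\<close> is an arbitrary choice, so uniqueness is what identifies it. Along
  the difference of two gradients the linear terms differ by \<open>r * n\<^sup>2\<close>, while the
  two errors add up to at most half of that.\<close>

lemma has_grad_d_unique:
  assumes g: "has_grad_d d f g x" and g': "has_grad_d d f g' x"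
  shows "g = g'"
proof (rule ccontr)
  assume ne: "g \<noteq> g'"
  have ext: "g \<in> Rd d" "g' \<in> Rd d" using g g' by (auto simp: has_grad_d_def)
  define v where "v = (\<lambda>i. g i - g' i)"
  define n where "n = norm_d d v"
  have "n > 0"
  proof (rule ccontr)
    assume "\<not> n > 0"
    then have "n = 0" using norm_d_nonneg[of d v] unfolding n_def by simp
    then have "(\<Sum>i<d. (v i)\<^sup>2) = 0" using norm_d_sq[of d v] unfolding n_def by simp
    then have "\<forall>i<d. g i = g' i" by (subst (asm) sum_nonneg_eq_0_iff) (auto simp: v_def)
    then have "g = g'" using ext unfolding Rd_def by (intro PiE_ext[of g "{..<d}" "\<lambda>_. UNIV" g']) auto
    then show False using ne by simp
  qed
  then have e: "n / 4 > 0" by simp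
  obtain s where s: "s > 0" "\<And>k. k \<in> Rd d \<Longrightarrow> norm_d d k < s \<Longrightarrow> \<bar>f (vadd_d d x k) - f x - inner_d d g k\<bar> \<le> n / 4 * norm_d d k"
    using g e unfolding has_grad_d_def by blast
  obtain s' where s': "s' > 0" "\<And>k. k \<in> Rd d \<Longrightarrow> norm_d d k < s' \<Longrightarrow> \<bar>f (vadd_d d x k) - f x - inner_d d g' k\<bar> \<le> n / 4 * norm_d d k"
    using g' e unfolding has_grad_d_def by blast
  \<comment> \<open>The step along \<open>v\<close> then has length \<open>r * n\<close>, half the
    smaller radius.\<close>
  define r where "r = min s s' / (2 * n)"
  have r: "r > 0" "r * n < s" "r * n < s'" using s(1) s'(1) \<open>n > 0\<close> unfolding r_def by (auto simp: min_def)
  define k where "k = restrict (\<lambda>i. r * v i) {..<d}"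
  have k: "k \<in> Rd d" unfolding k_def Rd_def by auto
  have "(norm_d d k)\<^sup>2 = (r * n)\<^sup>2"
    unfolding n_def power_mult_distrib norm_d_sq k_def by (simp add: power_mult_distrib sum_distrib_left)
  then have nk: "norm_d d k = r * n"
    using norm_d_nonneg[of d k] r(1) \<open>n > 0\<close> by (simp add: power2_eq_iff_nonneg)
  have "inner_d d g k - inner_d d g' k = r * n\<^sup>2"
    unfolding inner_d_def n_def norm_d_sq k_def
    by (simp add: sum_distrib_left v_def power2_eq_square algebra_simps flip: sum_subtractf)
  moreover have "\<bar>inner_d d g k - inner_d d g' k\<bar> \<le> 2 * (n / 4 * (r * n))"
    using s(2)[OF k] s'(2)[OF k] r unfolding nk by linarith
  ultimately have "r * n\<^sup>2 \<le> r * n\<^sup>2 / 2" using r(1) by (simp add: power2_eq_square)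
  then show False using r(1) \<open>n > 0\<close> by (simp add: field_simps)
qed

section \<open>Integration over products of lines\<close>

interpretation lborel_prod: product_sigma_finite "\<lambda>_::nat. lborel :: real measure" ..

lemma lebd_sigma_finite: "sigma_finite_measure (lebd d)"
  unfolding lebd_def by (rule lborel_prod.sigma_finite) simp

lemma space_lebd: "space (lebd d) = Rd d"
  unfolding lebd_def Rd_def space_PiM by simp

lemma lebd_component [measurable]: "i < d \<Longrightarrow> (\<lambda>x. x i) \<in> borel_measurable (lebd d)"
  unfolding lebd_def by measurable

lemma nn_integral_lebd_prod:
  assumes "\<And>i. i < d \<Longrightarrow> K i \<in> borel_measurable borel" "\<And>i x. K i x \<ge> 0"
  shows "(\<integral>\<^sup>+x. ennreal (\<Prod>i<d. K i (x i)) \<partial>lebd d) = (\<Prod>i<d. \<integral>\<^sup>+x. ennreal (K i x) \<partial>lborel)"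
  using lborel_prod.product_nn_integral_prod[of "{..<d}" "\<lambda>i x. ennreal (K i x)"] assms
  unfolding lebd_def by (simp add: prod_ennreal)

lemma nn_integral_lebd_prod2:
  assumes [measurable]: "\<And>i. i < d \<Longrightarrow> case_prod (K i) \<in> borel_measurable (borel \<Otimes>\<^sub>M borel)" and nn: "\<And>i x y. K i x y \<ge> 0"
  shows "(\<integral>\<^sup>+x. \<integral>\<^sup>+y. ennreal (\<Prod>i<d. K i (x i) (y i)) \<partial>lebd d \<partial>lebd d)
    = (\<Prod>i<d. \<integral>\<^sup>+x. \<integral>\<^sup>+y. ennreal (K i x y) \<partial>lborel \<partial>lborel)"
proof -
  have "(\<integral>\<^sup>+x. \<integral>\<^sup>+y. ennreal (\<Prod>i<d. K i (x i) (y i)) \<partial>lebd d \<partial>lebd d)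
    = (\<integral>\<^sup>+x. (\<Prod>i<d. \<integral>\<^sup>+y. ennreal (K i (x i) y) \<partial>lborel) \<partial>lebd d)"
    by (intro nn_integral_cong nn_integral_lebd_prod nn) measurable
  also have "\<dots> = (\<Prod>i<d. \<integral>\<^sup>+x. \<integral>\<^sup>+y. ennreal (K i x y) \<partial>lborel \<partial>lborel)"
    unfolding lebd_def by (rule lborel_prod.product_nn_integral_prod) (simp, measurable)
  finally show ?thesis .
qed

section \<open>Membership of the separable potential in the class\<close>

context ripple
begin

definition fd :: "nat \<Rightarrow> (nat \<Rightarrow> real) \<Rightarrow> real" where "fd d x = (\<Sum>i<d. pot (x i))"
definition gd :: "nat \<Rightarrow> (nat \<Rightarrow> real) \<Rightarrow> (nat \<Rightarrow> real)" where "gd d x = restrict (\<lambda>i. dpot (x i)) {..<d}"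

text \<open>The quadratic part equals its Taylor polynomial, so the error comes from the ripple
  alone. The two-sided bound yields smoothness and strong convexity at once.\<close>

lemma pot_taylor: "\<bar>pot y - pot x - dpot x * (y - x) - a / 2 * (y - x)\<^sup>2\<bar> \<le> dl * w\<^sup>2 / 2 * (y - x)\<^sup>2"
proof -
  have "\<bar>(- dl * cos (w * y)) - (- dl * cos (w * x)) - (dl * w * sin (w * x)) * (y - x)\<bar> \<le> dl * w\<^sup>2 / 2 * (y - x)\<^sup>2"
  proof (rule taylor2_bound[where f'' = "\<lambda>t. dl * w\<^sup>2 * cos (w * t)"])
    show "((\<lambda>t. - dl * cos (w * t)) has_real_derivative dl * w * sin (w * t)) (at t)" for t
      by (auto intro!: derivative_eq_intros)
    show "((\<lambda>t. dl * w * sin (w * t)) has_real_derivative dl * w\<^sup>2 * cos (w * t)) (at t)" for t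
      by (auto intro!: derivative_eq_intros simp: power2_eq_square)
    show "\<bar>dl * w\<^sup>2 * cos (w * t)\<bar> \<le> dl * w\<^sup>2" for t
      using dl_nonneg by (simp add: abs_mult mult_left_le)
  qed
  moreover have "a * y\<^sup>2 / 2 - a * x\<^sup>2 / 2 - a * x * (y - x) - a / 2 * (y - x)\<^sup>2 = 0"
    by (simp add: power2_eq_square algebra_simps add_divide_distrib diff_divide_distrib)
  then have "pot y - pot x - dpot x * (y - x) - a / 2 * (y - x)\<^sup>2 = (- dl * cos (w * y)) - (- dl * cos (w * x)) - (dl * w * sin (w * x)) * (y - x)"
    unfolding pot_def dpot_def distrib_right by simp
  ultimately show ?thesis by simp
qed

lemma dpot_taylor: "\<bar>dpot y - dpot x - (a + dl * w\<^sup>2 * cos (w * x)) * (y - x)\<bar> \<le> dl * \<bar>w\<bar> ^ 3 / 2 * (y - x)\<^sup>2"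
proof (rule taylor2_bound[where f'' = "\<lambda>t. - dl * w ^ 3 * sin (w * t)"])
  show "(dpot has_real_derivative a + dl * w\<^sup>2 * cos (w * t)) (at t)" for t
    unfolding dpot_def by (auto intro!: derivative_eq_intros simp: power2_eq_square)
  show "((\<lambda>t. a + dl * w\<^sup>2 * cos (w * t)) has_real_derivative - dl * w ^ 3 * sin (w * t)) (at t)" for t
    by (auto intro!: derivative_eq_intros simp: power2_eq_square power3_eq_cube)
  show "\<bar>- dl * w ^ 3 * sin (w * t)\<bar> \<le> dl * \<bar>w\<bar> ^ 3" for t
  proof -
    have "\<bar>- dl * w ^ 3 * sin (w * t)\<bar> = (dl * \<bar>w\<bar> ^ 3) * \<bar>sin (w * t)\<bar>"
      using dl_nonneg by (simp only: abs_mult power_abs abs_minus abs_of_nonneg)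
    also have "\<dots> \<le> (dl * \<bar>w\<bar> ^ 3) * 1"
      using dl_nonneg by (intro mult_left_mono) auto
    finally show ?thesis by simp
  qed
qed

lemma fd_taylor:
  "\<bar>fd d y - fd d x - inner_d d (gd d x) (vsub_d d y x) - a / 2 * (norm_d d (vsub_d d y x))\<^sup>2\<bar>
    \<le> dl * w\<^sup>2 / 2 * (norm_d d (vsub_d d y x))\<^sup>2"
proof -
  have n: "(norm_d d (vsub_d d y x))\<^sup>2 = (\<Sum>i<d. (y i - x i)\<^sup>2)"
    unfolding vsub_d_def norm_d_sq by simp
  have I: "inner_d d (gd d x) (vsub_d d y x) = (\<Sum>i<d. dpot (x i) * (y i - x i))"
    unfolding inner_d_def gd_def vsub_d_def by simp
  have "\<bar>\<Sum>i<d. pot (y i) - pot (x i) - dpot (x i) * (y i - x i) - a / 2 * (y i - x i)\<^sup>2\<bar>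
    \<le> (\<Sum>i<d. \<bar>pot (y i) - pot (x i) - dpot (x i) * (y i - x i) - a / 2 * (y i - x i)\<^sup>2\<bar>)"
    by (rule sum_abs)
  also have "\<dots> \<le> (\<Sum>i<d. dl * w\<^sup>2 / 2 * (y i - x i)\<^sup>2)"
    by (rule sum_mono) (rule pot_taylor)
  finally show ?thesis
    unfolding n I fd_def sum_distrib_left by (simp only: sum_subtractf)
qed

lemma fd_has_grad:
  assumes x: "x \<in> Rd d"
  shows "has_grad_d d (fd d) (gd d x) x"
  unfolding has_grad_d_def
proof (intro conjI allI impI)
  show "gd d x \<in> Rd d" unfolding gd_def Rd_def by auto
  fix e :: real assume e: "e > 0"
  define C where "C = a / 2 + dl * w\<^sup>2 / 2"
  have C: "C > 0" unfolding C_def using a_pos dl_nonneg by (simp add: add_pos_nonneg)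
  show "\<exists>\<delta>>0. \<forall>h\<in>Rd d. norm_d d h < \<delta> \<longrightarrow> \<bar>fd d (vadd_d d x h) - fd d x - inner_d d (gd d x) h\<bar> \<le> e * norm_d d h"
  proof (intro exI[of _ "e / C"] conjI ballI impI)
    show "e / C > 0" using e C by simp
    fix h assume h: "h \<in> Rd d" "norm_d d h < e / C"
    have "vsub_d d (vadd_d d x h) x = h"
      using h(1) unfolding vsub_d_def vadd_d_def Rd_def by (auto simp: restrict_def PiE_def extensional_def fun_eq_iff)
    have "\<bar>fd d (vadd_d d x h) - fd d x - inner_d d (gd d x) h\<bar> \<le> C * (norm_d d h)\<^sup>2"
    proof -
      have "0 \<le> a / 2 * (norm_d d h)\<^sup>2" using a_pos by simp
      then show ?thesis
        using abs_le_D1[OF fd_taylor[of d "vadd_d d x h" x]] abs_le_D2[OF fd_taylor[of d "vadd_d d x h" x]]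
        unfolding C_def distrib_right \<open>vsub_d d (vadd_d d x h) x = h\<close> by (intro abs_leI) linarith+
    qed
    also have "\<dots> = (C * norm_d d h) * norm_d d h" by (simp add: power2_eq_square)
    also have "\<dots> \<le> e * norm_d d h"
      using h(2) C norm_d_nonneg by (intro mult_right_mono) (auto simp: field_simps)
    finally show "\<bar>fd d (vadd_d d x h) - fd d x - inner_d d (gd d x) h\<bar> \<le> e * norm_d d h" .
  qed
qed

lemma grad_fd: "x \<in> Rd d \<Longrightarrow> grad_d d (fd d) x = gd d x"
  unfolding grad_d_def using fd_has_grad has_grad_d_unique by (metis someI)

lemma gd_has_jac: "\<exists>H. has_jac_d d (gd d) H x"
proof
  define H where "H i j = (if i = j then a + dl * w\<^sup>2 * cos (w * x i) else 0)" for i j :: nat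
  \<comment> \<open>The summand 1 keeps \<open>C\<close> positive when the ripple vanishes.\<close>
  define C where "C = 1 + dl * \<bar>w\<bar> ^ 3 / 2"
  have C: "C > 0" unfolding C_def using dl_nonneg by (simp add: add_pos_nonneg)
  show "has_jac_d d (gd d) H x"
    unfolding has_jac_d_def
  proof (intro allI impI)
    fix e :: real assume e: "e > 0"
    show "\<exists>\<delta>>0. \<forall>h\<in>Rd d. norm_d d h < \<delta> \<longrightarrow>
      norm_d d (\<lambda>i. gd d (vadd_d d x h) i - gd d x i - (\<Sum>j<d. H i j * h j)) \<le> e * norm_d d h"
    proof (intro exI[of _ "e / C"] conjI ballI impI)
      show "e / C > 0" using e C by simp
      fix h assume h: "h \<in> Rd d" "norm_d d h < e / C"
      let ?r = "\<lambda>i. gd d (vadd_d d x h) i - gd d x i - (\<Sum>j<d. H i j * h j)"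
      have le: "\<bar>h i\<bar> \<le> norm_d d h" if "i < d" for i
      proof (rule power2_le_imp_le[OF _ norm_d_nonneg])
        show "\<bar>h i\<bar>\<^sup>2 \<le> (norm_d d h)\<^sup>2"
          unfolding norm_d_sq power2_abs using that by (intro member_le_sum[of i "{..<d}" "\<lambda>i. (h i)\<^sup>2"]) auto
      qed
      have r: "\<bar>?r i\<bar> \<le> (C * norm_d d h) * \<bar>h i\<bar>" if i: "i < d" for i
      proof -
        have "(\<Sum>j<d. H i j * h j) = (\<Sum>j<d. if i = j then (a + dl * w\<^sup>2 * cos (w * x i)) * h j else 0)"
          by (intro sum.cong) (auto simp: H_def)
        then have "?r i = dpot (x i + h i) - dpot (x i) - (a + dl * w\<^sup>2 * cos (w * x i)) * ((x i + h i) - x i)"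
          using i by (simp add: gd_def vadd_d_def)
        then have "\<bar>?r i\<bar> \<le> dl * \<bar>w\<bar> ^ 3 / 2 * (h i)\<^sup>2"
          using dpot_taylor[of "x i + h i" "x i"] by simp
        also have "\<dots> \<le> C * (h i)\<^sup>2" unfolding C_def by (intro mult_right_mono) auto
        also have "\<dots> = C * \<bar>h i\<bar> * \<bar>h i\<bar>" by (simp add: power2_eq_square)
        also have "\<dots> \<le> (C * norm_d d h) * \<bar>h i\<bar>"
          using C le[OF i] by (intro mult_right_mono mult_left_mono) auto
        finally show ?thesis .
      qed
      have "(norm_d d ?r)\<^sup>2 \<le> ((C * norm_d d h) * norm_d d h)\<^sup>2"
        unfolding norm_d_sq power_mult_distrib[of "C * norm_d d h"] sum_distrib_left
      proof (intro sum_mono)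
        fix i assume "i \<in> {..<d}"
        then have "\<bar>?r i\<bar>\<^sup>2 \<le> ((C * norm_d d h) * \<bar>h i\<bar>)\<^sup>2" by (intro power_mono r) auto
        then show "(?r i)\<^sup>2 \<le> (C * norm_d d h)\<^sup>2 * (h i)\<^sup>2" by (simp add: power_mult_distrib)
      qed
      then have "norm_d d ?r \<le> (C * norm_d d h) * norm_d d h"
        by (rule power2_le_imp_le) (use C norm_d_nonneg in auto)
      also have "\<dots> \<le> e * norm_d d h"
        using h(2) C norm_d_nonneg by (intro mult_right_mono) (auto simp: field_simps)
      finally show "norm_d d ?r \<le> e * norm_d d h" .
    qed
  qed
qed

lemma fd_in_class:
  assumes "m \<le> a - dl * w\<^sup>2" "a + dl * w\<^sup>2 \<le> L"
  shows "in_class d L m (fd d)"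
  unfolding in_class_def
proof (intro conjI ballI)
  show "twice_diff_d d (fd d)"
    unfolding twice_diff_d_def using fd_has_grad gd_has_jac by (intro exI[of _ "gd d"]) auto
  fix x y assume x: "x \<in> Rd d"
  let ?n = "(norm_d d (vsub_d d y x))\<^sup>2"
  have "m / 2 * ?n \<le> (a - dl * w\<^sup>2) / 2 * ?n" "(a + dl * w\<^sup>2) / 2 * ?n \<le> L / 2 * ?n"
    using assms by (auto intro!: mult_right_mono)
  then have "m / 2 * ?n \<le> a / 2 * ?n - dl * w\<^sup>2 / 2 * ?n" "a / 2 * ?n + dl * w\<^sup>2 / 2 * ?n \<le> L / 2 * ?n"
    by (simp_all only: diff_divide_distrib add_divide_distrib left_diff_distrib distrib_right)
  then show "fd d y \<le> fd d x + inner_d d (grad_d d (fd d) x) (vsub_d d y x) + L / 2 * ?n"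
    and "fd d x + inner_d d (grad_d d (fd d) x) (vsub_d d y x) + m / 2 * ?n \<le> fd d y"
    using abs_le_D1[OF fd_taylor[of d y x]] abs_le_D2[OF fd_taylor[of d y x]] unfolding grad_fd[OF x] by linarith+
qed

end

section \<open>MALA on a separable target as a reversible kernel\<close>

locale mala_ripple = ripple +
  fixes d :: nat and h :: real
  assumes h_pos: "h > 0" and d_pos: "d > 0"
begin

definition pd :: "(nat \<Rightarrow> real) \<Rightarrow> real" where "pd x = (\<Prod>i<d. dens (x i))"
definition qd :: "(nat \<Rightarrow> real) \<Rightarrow> (nat \<Rightarrow> real) \<Rightarrow> real" where "qd x y = (\<Prod>i<d. prop1 h (x i) (y i))"
text \<open>Acceptance probability times proposal density, with the proposal density moved inside
  the minimum.\<close>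

definition kd :: "(nat \<Rightarrow> real) \<Rightarrow> (nat \<Rightarrow> real) \<Rightarrow> real" where "kd x y = min (qd x y) (pd y * qd y x / pd x)"

lemma pd_pos: "pd x > 0" unfolding pd_def by (intro prod_pos) (simp add: dens_pos)

lemma prop1_pos: "prop1 h x y > 0"
  unfolding prop1_def using h_pos by (simp add: normal_density_pos)

lemma qd_pos: "qd x y > 0"
  unfolding qd_def by (intro prod_pos) (simp add: prop1_pos)

lemma kd_nonneg: "kd x y \<ge> 0"
  unfolding kd_def using pd_pos[of x] pd_pos[of y] qd_pos[of x y] qd_pos[of y x] by (simp add: less_imp_le)

lemma pd_measurable [measurable]: "pd \<in> borel_measurable (lebd d)"
  unfolding pd_def by measurable

lemma prop1_measurable2:
  "f \<in> borel_measurable N \<Longrightarrow> g \<in> borel_measurable N \<Longrightarrow> (\<lambda>z. prop1 h (f z) (g z)) \<in> borel_measurable N"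
  using measurable_compose[OF measurable_Pair prop1_measurable[of h], of f N g] by simp

lemma qd_measurable [measurable]:
  "(\<lambda>z. qd (fst z) (snd z)) \<in> borel_measurable (lebd d \<Otimes>\<^sub>M lebd d)"
  "(\<lambda>z. qd (snd z) (fst z)) \<in> borel_measurable (lebd d \<Otimes>\<^sub>M lebd d)"
  unfolding qd_def by (auto intro!: borel_measurable_prod prop1_measurable2 measurable_compose[OF _ lebd_component])

lemma kd_measurable: "case_prod kd \<in> borel_measurable (lebd d \<Otimes>\<^sub>M lebd d)"
  unfolding kd_def case_prod_unfold by measurable

text \<open>The right side is symmetric in \<open>x\<close> and \<open>y\<close>, which is the
  detailed balance of Metropolis chains. It is also the minimum that the geometric mean
  dominates.\<close>

lemma balance_min: "pd x * kd x y = min (pd x * qd x y) (pd y * qd y x)"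
  unfolding kd_def using pd_pos[of x] by (simp add: min_mult_distrib_left)

lemma nn_pd: "(\<integral>\<^sup>+x. pd x \<partial>lebd d) = 1"
  unfolding pd_def using nn_integral_lebd_prod[of d "\<lambda>_. dens"] by (simp add: dens_nonneg nn_dens_one)

lemma nn_qd: "(\<integral>\<^sup>+y. qd x y \<partial>lebd d) = 1"
  unfolding qd_def using nn_integral_lebd_prod[of d "\<lambda>i. prop1 h (x i)"]
  by (simp add: prop1_nonneg nn_prop1[OF h_pos] prop1_measurable2)

sublocale K: reversible_kernel "lebd d" pd kd
proof (intro reversible_kernel.intro reversible_kernel_axioms.intro)
  show "sigma_finite_measure (lebd d)" by (rule lebd_sigma_finite)
  show "(\<integral>\<^sup>+x. pd x \<partial>lebd d) = 1" by (rule nn_pd)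
  show "(\<integral>\<^sup>+y. kd x y \<partial>lebd d) \<le> 1" for x
    unfolding nn_qd[of x, symmetric] by (intro nn_integral_mono ennreal_leI) (simp add: kd_def)
  show "pd x * kd x y = pd y * kd y x" for x y unfolding balance_min by (rule min.commute)
qed (auto simp: kd_measurable kd_nonneg pd_pos less_imp_le)

lemma exp_fd: "exp (- fd d x) = Z ^ d * pd x"
proof -
  have "exp (- fd d x) = (\<Prod>i<d. exp (- pot (x i)))"
    unfolding fd_def sum_negf[symmetric] by (simp add: exp_sum)
  then show ?thesis unfolding pd_def dens_def prod_dividef using Z_pos by simp
qed

lemma exp_fd_integral: "(\<integral>x. exp (- fd d x) \<partial>lebd d) = Z ^ d"
  unfolding exp_fd by (simp add: K.p_integral)

lemma target_fd: "target d (fd d) = K.law (\<lambda>_. 1)"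
  unfolding target_def K.law_def exp_fd_integral unfolding exp_fd using Z_pos by simp

text \<open>Matches the product of one-dimensional normalising constants with the
  \<open>powr\<close> in the d-dimensional proposal density.\<close>

lemma inverse_sqrt_power:
  fixes c :: real
  assumes c: "c > 0"
  shows "(1 / sqrt c) ^ n = c powr (- real n / 2)"
proof -
  have root: "1 / sqrt c = c powr (- (1/2))"
    using c unfolding powr_minus_divide by (simp only: powr_half_sqrt[OF less_imp_le])
  have "(1 / sqrt c) ^ n = (1 / sqrt c) powr real n"
    using c by (intro powr_realpow[symmetric]) simp
  also have "\<dots> = (c powr (- (1/2))) powr real n" by (simp only: root)
  also have "\<dots> = c powr (- real n / 2)" unfolding powr_powr by (rule arg_cong[of _ _ "(powr) c"]) simp
  finally show ?thesis .
qed

lemma prop_dens_fd: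
  assumes x: "x \<in> Rd d"
  shows "prop_dens d (fd d) h x y = qd x y"
proof -
  let ?c = "4 * pi * h" and ?r = "\<lambda>i. y i - (x i - h * dpot (x i))"
  have "prop1 h (x i) (y i) = 1 / sqrt ?c * exp (- (?r i)\<^sup>2 / (4 * h))" for i
    unfolding prop1_def normal_density_def using h_pos by (simp add: mult.assoc)
  then have "qd x y = (1 / sqrt ?c) ^ d * exp (\<Sum>i<d. - (?r i)\<^sup>2 / (4 * h))"
    unfolding qd_def by (simp only: prod.distrib prod_constant exp_sum finite_lessThan card_lessThan)
  moreover have "(1 / sqrt ?c) ^ d = ?c powr (- real d / 2)"
    using h_pos by (intro inverse_sqrt_power) simp
  moreover have "(\<Sum>i<d. - (?r i)\<^sup>2 / (4 * h)) = - (norm_d d (\<lambda>i. y i - (x i - h * grad_d d (fd d) x i)))\<^sup>2 / (4 * h)"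
    unfolding grad_fd[OF x] norm_d_sq gd_def by (simp add: sum_negf sum_divide_distrib)
  ultimately show ?thesis unfolding prop_dens_def by (simp only:)
qed

lemma accept_fd:
  assumes x: "x \<in> Rd d" and y: "y \<in> Rd d"
  shows "accept d (fd d) h x y * prop_dens d (fd d) h x y = kd x y"
proof -
  have "exp (fd d x - fd d y) = exp (- fd d y) / exp (- fd d x)" unfolding exp_diff[symmetric] by simp
  also have "\<dots> = pd y / pd x" unfolding exp_fd using Z_pos by simp
  finally have e: "exp (fd d x - fd d y) = pd y / pd x" .
  have m: "min 1 (v / q) * q = min q v" if "q > 0" for v q :: real
    using that by (auto simp: min_def field_simps)
  have "accept d (fd d) h x y * prop_dens d (fd d) h x y = min 1 (pd y / pd x * qd y x / qd x y) * qd x y"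
    unfolding accept_def prop_dens_fd[OF x] prop_dens_fd[OF y] e by (rule refl)
  also have "\<dots> = min (qd x y) (pd y / pd x * qd y x)" by (rule m[OF qd_pos])
  also have "\<dots> = kd x y" unfolding kd_def by (simp only: times_divide_eq_left)
  finally show ?thesis .
qed

lemma mala_kernel_fd:
  assumes x: "x \<in> Rd d"
  shows "mala_kernel d (fd d) h x S = (\<integral>\<^sup>+y. ennreal (kd x y) * indicator S y \<partial>lebd d)
     + (1 - (\<integral>\<^sup>+y. ennreal (kd x y) \<partial>lebd d)) * indicator S x"
  unfolding mala_kernel_def
  by (simp add: accept_fd[OF x] space_lebd cong: nn_integral_cong_simp)

text \<open>\<open>mala_step\<close> applies \<open>measure_of\<close> to a bare set function. Once
  this function agrees on measurable sets with a law that is already a measure,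
  \<open>measure_of\<close> returns that law.\<close>

lemma mala_step_fd:
  assumes r: "r \<in> K.bdd B" "\<And>x. x \<in> Rd d \<Longrightarrow> r x \<ge> 0"
  shows "mala_step d (fd d) h (K.law r) = K.law (K.op r)"
proof -
  have "mala_step d (fd d) h (K.law r) = measure_of (Rd d) (sets (lebd d)) (emeasure (K.law (K.op r)))"
    unfolding mala_step_def
  proof (rule measure_of_eq)
    show "sets (lebd d) \<subseteq> Pow (Rd d)" using sets.space_closed[of "lebd d"] by (simp add: space_lebd)
    fix S assume "S \<in> sigma_sets (Rd d) (sets (lebd d))"
    then have S: "S \<in> sets (lebd d)" by (metis sets.sigma_sets_eq space_lebd)
    have "(\<integral>\<^sup>+x. mala_kernel d (fd d) h x S \<partial>K.law r) = (\<integral>\<^sup>+x. ((\<integral>\<^sup>+y. ennreal (kd x y) * indicator S y \<partial>lebd d)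
     + (1 - (\<integral>\<^sup>+y. ennreal (kd x y) \<partial>lebd d)) * indicator S x) \<partial>K.law r)"
      by (intro nn_integral_cong mala_kernel_fd) (simp add: K.law_def space_lebd)
    also have "\<dots> = emeasure (K.law (K.op r)) S"
      using r S by (intro K.nn_step) (auto simp: space_lebd)
    finally show "(\<integral>\<^sup>+x. mala_kernel d (fd d) h x S \<partial>K.law r) = emeasure (K.law (K.op r)) S" .
  qed
  also have "\<dots> = K.law (K.op r)"
    using measure_of_of_measure[of "K.law (K.op r)"] by (simp add: K.law_def space_lebd)
  finally show ?thesis .
qed

text \<open>\<open>K.op_add_one\<close> speaks of points of the space only, so the functions
  compared are known to coincide on \<open>Rd d\<close>; the laws see nothing else.\<close>

lemma law_cong: "(\<And>x. x \<in> Rd d \<Longrightarrow> r x = s x) \<Longrightarrow> s \<in> borel_measurable (lebd d) \<Longrightarrow> K.law r = K.law s"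
  unfolding K.law_def
proof (rule density_cong)
  assume rs: "\<And>x. x \<in> Rd d \<Longrightarrow> r x = s x" and [measurable]: "s \<in> borel_measurable (lebd d)"
  have [measurable]: "r \<in> borel_measurable (lebd d)"
    using rs by (subst measurable_cong[where g=s]) (auto simp: space_lebd)
  show "(\<lambda>x. ennreal (pd x * r x)) \<in> borel_measurable (lebd d)" by measurable
  show "(\<lambda>x. ennreal (pd x * s x)) \<in> borel_measurable (lebd d)" by measurable
  show "AE x in lebd d. ennreal (pd x * r x) = ennreal (pd x * s x)"
    using rs by (auto simp: space_lebd)
qed

text \<open>One coordinate suffices. The sine is odd, so \<open>g\<close> has mean zero under the
  target; it is bounded by 1, so \<open>1 + g\<close> is a density; and its frequency keeps the
  variance of constant order for every \<open>a\<close>.\<close>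

definition g :: "(nat \<Rightarrow> real) \<Rightarrow> real" where "g x = sin (sqrt a * x 0)"

lemma g_bdd: "g \<in> K.bdd 1"
  unfolding K.bdd_def g_def using d_pos by auto

lemma mala_law_fd: "mala_law d (fd d) h (K.law (\<lambda>x. 1 + g x)) n = K.law (\<lambda>x. 1 + (K.op ^^ n) g x)"
proof (induction n)
  case (Suc n)
  note b = K.op_pow_density[OF g_bdd]
  have "mala_law d (fd d) h (K.law (\<lambda>x. 1 + g x)) (Suc n) = mala_step d (fd d) h (K.law (\<lambda>x. 1 + (K.op ^^ n) g x))"
    using Suc by (simp add: mala_law_def)
  also have "\<dots> = K.law (K.op (\<lambda>x. 1 + (K.op ^^ n) g x))"
    by (rule mala_step_fd[OF b(1)]) (simp add: b(2) space_lebd)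
  also have "\<dots> = K.law (\<lambda>x. 1 + (K.op ^^ Suc n) g x)"
    using K.op_add_one[OF K.op_pow_bdd[OF g_bdd]] b(1)[of "Suc n"]
    by (intro law_cong) (auto simp: space_lebd K.bdd_def)
  finally show ?case .
qed (simp add: mala_law_def)

lemma pd_head: "pd x * F (x 0) = (\<Prod>i<d. dens (x i) * (if i = 0 then F (x i) else 1))"
  unfolding pd_def prod.distrib using d_pos by (simp add: prod.delta)

lemma nn_pd_head:
  assumes [measurable]: "F \<in> borel_measurable borel" and nn: "\<And>x. F x \<ge> 0"
  shows "(\<integral>\<^sup>+x. ennreal (pd x * F (x 0)) \<partial>lebd d) = (\<integral>\<^sup>+x. ennreal (dens x * F x) \<partial>lborel)"
proof -
  have "(\<integral>\<^sup>+x. ennreal (pd x * F (x 0)) \<partial>lebd d) = (\<Prod>i<d. \<integral>\<^sup>+x. ennreal (dens x * (if i = 0 then F x else 1)) \<partial>lborel)"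
    unfolding pd_head by (rule nn_integral_lebd_prod) (auto simp: nn dens_nonneg)
  also have "\<dots> = (\<Prod>i<d. if i = 0 then (\<integral>\<^sup>+x. ennreal (dens x * F x) \<partial>lborel) else 1)"
    by (intro prod.cong) (auto simp: nn_dens_one)
  finally show ?thesis using d_pos by simp
qed

lemma warm_start:
  assumes M: "M \<ge> 2"
  shows "warm d M (fd d) (K.law (\<lambda>x. 1 + g x))"
  unfolding warm_def target_fd
proof (intro conjI ballI)
  have gm [measurable]: "g \<in> borel_measurable (lebd d)" using g_bdd by (rule K.bddD)
  have s: "1 + sin t \<ge> 0" for t :: real using sin_ge_minus_one[of t] by linarith
  show "prob_space (K.law (\<lambda>x. 1 + g x))"
    unfolding K.law_def
  proof (rule prob_spaceI, subst emeasure_density)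
    show "(\<integral>\<^sup>+x. ennreal (pd x * (1 + g x)) * indicator (space (density (lebd d) (\<lambda>x. ennreal (pd x * (1 + g x))))) x \<partial>lebd d) = 1"
      using nn_pd_head[of "\<lambda>t. 1 + sin (sqrt a * t)"] s
      by (simp add: g_def nn_dens_sin cong: nn_integral_cong)
  qed auto
  show "sets (K.law (\<lambda>x. 1 + g x)) = sets (lebd d)" by (simp add: K.law_def)
  fix S assume S: "S \<in> sets (lebd d)"
  have i: "(indicator S :: _ \<Rightarrow> real) \<in> K.bdd 1" using S by (auto simp: K.bdd_def indicator_def)
  have b1: "(\<lambda>x. 1 + g x) \<in> K.bdd 2" and o: "(\<lambda>x. 1) \<in> K.bdd 1"
    using K.op_pow_density(1)[OF g_bdd, of 0] by (auto simp: K.bdd_def)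
  have nn: "1 + g x \<ge> 0" for x unfolding g_def by (rule s)
  have "measure (K.law (\<lambda>x. 1 + g x)) S = (\<integral>x. pd x * ((1 + g x) * indicator S x) \<partial>lebd d)"
    by (rule K.measure_law[OF b1 _ S]) (simp add: nn)
  also have "\<dots> \<le> (\<integral>x. M * (pd x * (1 * indicator S x)) \<partial>lebd d)"
  proof (intro integral_mono K.scal_integrable[OF b1 i] integrable_mult_right K.scal_integrable[OF o i])
    fix x
    have "1 + g x \<le> M" unfolding g_def using sin_le_one[of "sqrt a * x 0"] M by linarith
    then have "(1 + g x) * (pd x * indicator S x) \<le> M * (pd x * indicator S x)"
      using pd_pos[of x] by (intro mult_right_mono) (auto simp: indicator_def)
    then show "pd x * ((1 + g x) * indicator S x) \<le> M * (pd x * (1 * indicator S x))"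
      by (simp add: mult_ac)
  qed
  also have "\<dots> = M * (\<integral>x. pd x * (1 * indicator S x) \<partial>lebd d)" by simp
  also have "(\<integral>x. pd x * (1 * indicator S x) \<partial>lebd d) = measure (K.law (\<lambda>_. 1)) S"
    by (rule K.measure_law[OF o _ S, symmetric]) simp
  finally show "measure (K.law (\<lambda>x. 1 + g x)) S \<le> M * measure (K.law (\<lambda>_. 1)) S" .
qed

lemma variance_lower:
  assumes dl: "dl \<le> 1/3"
  shows "K.mom g 0 \<ge> 1/8"
proof -
  have i: "integrable lborel (\<lambda>x. dens x * (sin (sqrt a * x))\<^sup>2)"
    by (rule dens_integrable[of _ 1]) (auto simp: abs_square_le_1)
  have gm [measurable]: "g \<in> borel_measurable (lebd d)" using g_bdd by (rule K.bddD)
  have "K.mom g 0 = enn2real (\<integral>\<^sup>+x. ennreal (pd x * (g x)\<^sup>2) \<partial>lebd d)"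
    unfolding K.mom_def K.scal_def power2_eq_square using pd_pos
    by (simp, intro integral_eq_nn_integral) (auto simp: less_imp_le)
  also have "(\<integral>\<^sup>+x. ennreal (pd x * (g x)\<^sup>2) \<partial>lebd d) = (\<integral>\<^sup>+x. ennreal (dens x * (sin (sqrt a * x))\<^sup>2) \<partial>lborel)"
    unfolding g_def using nn_pd_head[of "\<lambda>t. (sin (sqrt a * t))\<^sup>2"] by simp
  also have "\<dots> = ennreal (\<integral>x. dens x * (sin (sqrt a * x))\<^sup>2 \<partial>lborel)"
    by (intro nn_integral_eq_integral i) (auto simp: dens_nonneg)
  finally have e: "K.mom g 0 = (\<integral>x. dens x * (sin (sqrt a * x))\<^sup>2 \<partial>lborel)"
    by (simp add: dens_nonneg integral_nonneg_AE)
  \<comment> \<open>The first factor is at least 1/3 and the second at least 3/8, whence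
    1/8.\<close>
  have "exp (- 2 * dl) \<ge> 1 + (- 2 * dl)" by (rule exp_ge_add_one_self)
  then have 1: "exp (- 2 * dl) \<ge> 1/3" using dl by simp
  have "exp (2::real) \<ge> 1 + 2 + 2\<^sup>2 / 2" by (rule exp_lower_Taylor_quadratic) simp
  then have 2: "exp (- 2) \<le> (1/4 :: real)" by (simp add: exp_minus field_simps)
  have "1/3 * ((1 - 1/4) / 2) \<le> exp (- 2 * dl) * ((1 - exp (- 2)) / 2)"
    using 1 2 by (intro mult_mono) auto
  then show ?thesis unfolding e using dens_sin2_lower by simp
qed

text \<open>A gap of \<open>eta\<close> against a variance of at least 1/8 makes
  \<open>1 - 8 * eta\<close> an admissible decay rate. The factor 32 is 16 from comparing this rate
  with an exponential, times 2 from rounding the number of steps up to even.\<close>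

lemma tau_lower:
  assumes dl: "dl \<le> 1/3" and eta: "0 < eta" "eta \<le> 1/16" and gap: "K.mom g 0 - K.mom g 1 \<le> eta" and eps: "0 < eps"
  shows "ereal (ln ((1/16) / eps) / (32 * eta)) \<le> ereal_of_enat (tau_tv d (fd d) h eps (K.law (\<lambda>x. 1 + g x)))"
proof -
  define R where "R = ln ((1/16) / eps) / (32 * eta)"
  \<comment> \<open>The mixing time is an \<open>enat\<close>, so the real bound is rounded up; a
    negative one becomes 0.\<close>
  define k where "k = nat \<lceil>R\<rceil>"
  have "enat k \<le> tau_tv d (fd d) h eps (K.law (\<lambda>x. 1 + g x))"
    unfolding tau_tv_def
  proof (rule Inf_greatest, clarify)
    fix n assume tv: "tv_le d (mala_law d (fd d) h (K.law (\<lambda>x. 1 + g x)) n) (target d (fd d)) eps"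
    define r where "r = 1 - 8 * eta"
    define N where "N = 2 * ((n + 1) div 2)"
    have mom: "K.mom g 0 \<ge> 1/8" by (rule variance_lower[OF dl])
    have r: "0 < r" "r \<le> 1" using eta by (auto simp: r_def)
    have "eta * 1 \<le> eta * (8 * K.mom g 0)" using mom eta by (intro mult_left_mono) auto
    then have rm: "r * K.mom g 0 \<le> K.mom g 1"
      using gap unfolding r_def left_diff_distrib by linarith
    have "K.mom g 0 * r ^ N \<le> 2 * eps"
      unfolding N_def
    proof (rule K.mixing_lower[OF g_bdd r rm])
      show "K.mom g 0 > 0" using mom by simp
      show "\<bar>measure (K.law (\<lambda>x. 1 + (K.op ^^ n) g x)) S - measure (K.law (\<lambda>_. 1)) S\<bar> \<le> eps"
        if "S \<in> sets (lebd d)" for S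
        using tv that unfolding tv_le_def mala_law_fd target_fd by blast
    qed
    moreover have "1/8 * r ^ N \<le> K.mom g 0 * r ^ N" using mom r by (intro mult_right_mono) auto
    ultimately have le: "r ^ N \<le> 16 * eps" by simp
    \<comment> \<open>For positive eta, (1 + 16 eta) (1 - 8 eta) \<ge> 1 holds exactly when eta
      \<le> 1/16.\<close>
    have "exp (- 16 * eta) \<le> r"
    proof -
      have "exp (16 * eta) * r \<ge> (1 + 16 * eta) * r" using r by (intro mult_right_mono exp_ge_add_one_self) auto
      moreover have "(1 + 16 * eta) * r \<ge> 1"
        using mult_left_mono[OF eta(2), of eta] eta(1) by (simp add: r_def algebra_simps)
      ultimately show ?thesis by (simp add: exp_minus field_simps)
    qed
    then have "exp (- 16 * eta) ^ N \<le> r ^ N" by (intro power_mono) auto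
    then have "exp (real N * (- 16 * eta)) \<le> 16 * eps" using le unfolding exp_of_nat_mult by linarith
    then have "real N * (- 16 * eta) \<le> ln (16 * eps)" using eps by (subst ln_ge_iff) auto
    moreover have "ln ((1/16) / eps) = - ln (16 * eps)" using eps by (simp add: ln_div ln_mult)
    ultimately have "ln ((1/16) / eps) \<le> 16 * eta * N" by (simp add: mult_ac)
    also have "\<dots> \<le> 16 * eta * (2 * real n)"
    proof (rule mult_left_mono)
      \<comment> \<open>\<open>N\<close> is \<open>n\<close> or \<open>n + 1\<close>, and it is 0
        for \<open>n = 0\<close>.\<close>
      have "N \<le> 2 * n" unfolding N_def by presburger
      then show "real N \<le> 2 * real n" by linarith
    qed (use eta in simp)
    finally have "R \<le> real n" unfolding R_def using eta by (simp add: divide_le_eq mult_ac)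
    then have "k \<le> n" unfolding k_def by linarith
    then show "enat k \<le> enat n" by simp
  qed
  then have "ereal_of_enat (enat k) \<le> ereal_of_enat (tau_tv d (fd d) h eps (K.law (\<lambda>x. 1 + g x)))"
    by (simp only: ereal_of_enat_le_iff)
  moreover have "ereal R \<le> ereal_of_enat (enat k)" unfolding k_def by (simp, linarith)
  ultimately show ?thesis unfolding R_def by (rule order_trans[rotated])
qed

section \<open>Upper bounds for the Dirichlet form\<close>

lemma gap_le:
  assumes F: "\<And>x y. x \<in> Rd d \<Longrightarrow> y \<in> Rd d \<Longrightarrow> pd x * kd x y * ((g x - g y)\<^sup>2 / 2) \<le> F x y"
    and I: "(\<integral>\<^sup>+x. \<integral>\<^sup>+y. ennreal (F x y) \<partial>lebd d \<partial>lebd d) \<le> ennreal C" and C: "C \<ge> 0"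
  shows "K.mom g 0 - K.mom g 1 \<le> C"
proof -
  have gm [measurable]: "g \<in> borel_measurable (lebd d)" using g_bdd by (rule K.bddD)
  have [measurable]: "(\<lambda>(x, y). pd x * kd x y * ((g x - g y)\<^sup>2 / 2)) \<in> borel_measurable (lebd d \<Otimes>\<^sub>M lebd d)"
    using K.k_measurable by measurable
  have "K.mom g 0 - K.mom g 1 = (\<integral>(x, y). pd x * kd x y * ((g x - g y)\<^sup>2 / 2) \<partial>(lebd d \<Otimes>\<^sub>M lebd d))"
    unfolding K.mom_def using K.dirichlet[OF g_bdd] by simp
  also have "\<dots> = enn2real (\<integral>\<^sup>+z. ennreal (case z of (x, y) \<Rightarrow> pd x * kd x y * ((g x - g y)\<^sup>2 / 2)) \<partial>(lebd d \<Otimes>\<^sub>M lebd d))"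
    using pd_pos kd_nonneg by (intro integral_eq_nn_integral AE_I2) (auto simp: less_imp_le)
  also have "\<dots> \<le> C"
  proof (rule enn2real_leI[OF C])
    have "(\<integral>\<^sup>+z. ennreal (case z of (x, y) \<Rightarrow> pd x * kd x y * ((g x - g y)\<^sup>2 / 2)) \<partial>(lebd d \<Otimes>\<^sub>M lebd d))
      = (\<integral>\<^sup>+x. \<integral>\<^sup>+y. ennreal (pd x * kd x y * ((g x - g y)\<^sup>2 / 2)) \<partial>lebd d \<partial>lebd d)"
      by (subst K.nn_integral_fst[symmetric]) auto
    also have "\<dots> \<le> (\<integral>\<^sup>+x. \<integral>\<^sup>+y. ennreal (F x y) \<partial>lebd d \<partial>lebd d)"
      by (intro nn_integral_mono ennreal_leI F) (auto simp: space_lebd)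
    finally show "(\<integral>\<^sup>+z. ennreal (case z of (x, y) \<Rightarrow> pd x * kd x y * ((g x - g y)\<^sup>2 / 2)) \<partial>(lebd d \<Otimes>\<^sub>M lebd d)) \<le> ennreal C"
      using I by simp
  qed
  finally show ?thesis .
qed

text \<open>Rejection only lowers the Dirichlet form, so \<open>kd\<close> may be replaced by
  \<open>qd\<close>. What remains is the mean squared increment of \<open>g\<close> under the
  proposal, of order \<open>a * h\<close> for small steps.\<close>

lemma gap_gaussian:
  assumes dl: "dl = 0"
  shows "K.mom g 0 - K.mom g 1 \<le> 3/2 * (a * h)"
proof -
  let ?c = "\<lambda>x y. 1 - cos (sqrt a * (x - y))"
  let ?K = "\<lambda>i x y. dens x * prop1 h x y * (if i = (0::nat) then ?c x y else 1)"
  have z: "a * h > 0" using a_pos h_pos by simp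
  have "K.mom g 0 - K.mom g 1 \<le> 1 - exp (- (a * h) - (a * h)\<^sup>2 / 2)"
  proof (rule gap_le[where F="\<lambda>x y. \<Prod>i<d. ?K i (x i) (y i)"])
    fix x y
    have "pd x * kd x y * ((g x - g y)\<^sup>2 / 2) \<le> pd x * qd x y * ?c (x 0) (y 0)"
    proof (intro mult_mono)
      \<comment> \<open>The squared chord between two points of the unit circle; dropping its cosine
        part leaves a bound by a function of the difference, whose mean is known.\<close>
      have "(sin s - sin t)\<^sup>2 + (cos s - cos t)\<^sup>2 = 2 - 2 * cos (s - t)" for s t :: real
        using sin_cos_squared_add[of s] sin_cos_squared_add[of t] by (simp add: power2_diff cos_diff algebra_simps)
      from this[of "sqrt a * x 0" "sqrt a * y 0"]
      show "(g x - g y)\<^sup>2 / 2 \<le> ?c (x 0) (y 0)"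
        using zero_le_power2[of "cos (sqrt a * x 0) - cos (sqrt a * y 0)"]
        unfolding g_def right_diff_distrib by linarith
    qed (use pd_pos[of x] qd_pos[of x y] kd_nonneg[of x y] in \<open>auto simp: kd_def less_imp_le\<close>)
    also have "\<dots> = (\<Prod>i<d. ?K i (x i) (y i))"
      unfolding pd_def qd_def prod.distrib using d_pos by (simp add: prod.delta)
    finally show "pd x * kd x y * ((g x - g y)\<^sup>2 / 2) \<le> (\<Prod>i<d. ?K i (x i) (y i))" .
  next
    have "(\<integral>\<^sup>+x. \<integral>\<^sup>+y. ennreal (\<Prod>i<d. ?K i (x i) (y i)) \<partial>lebd d \<partial>lebd d)
      = (\<Prod>i<d. \<integral>\<^sup>+x. \<integral>\<^sup>+y. ennreal (?K i x y) \<partial>lborel \<partial>lborel)"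
      by (rule nn_integral_lebd_prod2) (auto simp: dens_nonneg prop1_nonneg)
    also have "\<dots> = (\<Prod>i<d. if i = 0 then ennreal (1 - exp (- (a * h) - (a * h)\<^sup>2 / 2)) else 1)"
      using joint_increment[OF h_pos dl] joint_one[OF h_pos] by (intro prod.cong) auto
    also have "\<dots> = ennreal (1 - exp (- (a * h) - (a * h)\<^sup>2 / 2))" using d_pos by simp
    finally show "(\<integral>\<^sup>+x. \<integral>\<^sup>+y. ennreal (\<Prod>i<d. ?K i (x i) (y i)) \<partial>lebd d \<partial>lebd d) \<le> ennreal (1 - exp (- (a * h) - (a * h)\<^sup>2 / 2))"
      by simp
    have "- (a * h) - (a * h)\<^sup>2 / 2 \<le> 0" using z zero_le_power2[of "a * h"] by linarith
    then show "0 \<le> 1 - exp (- (a * h) - (a * h)\<^sup>2 / 2)" by simp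
  qed
  also have "\<dots> \<le> 3/2 * (a * h)"
  \<comment> \<open>For \<open>a * h > 1\<close> the left side is below 1 and the right side above
    it.\<close>
  proof (cases "a * h \<le> 1")
    case True
    have "1 + (- (a * h) - (a * h)\<^sup>2 / 2) \<le> exp (- (a * h) - (a * h)\<^sup>2 / 2)" by (rule exp_ge_add_one_self)
    moreover have "(a * h)\<^sup>2 \<le> a * h" using True z by (simp add: power2_eq_square mult_left_le)
    ultimately show ?thesis by linarith
  next
    case False
    then show ?thesis using exp_gt_zero[of "- (a * h) - (a * h)\<^sup>2 / 2"] by linarith
  qed
  finally show ?thesis .
qed

text \<open>The squared increment of \<open>g\<close> is at most 4, which leaves twice the mean
  acceptance probability. The minimum in \<open>balance_min\<close> does not factorise over
  coordinates, but the geometric mean above it does, with \<open>1 - D\<^sup>2 / 8\<close> bounding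
  each factor.\<close>

lemma gap_affinity:
  assumes D: "0 \<le> D" "D \<le> exp (- dl) * (exp (- w\<^sup>2 / (2 * a)) + (1 - exp (- dl)) / 2) - exp (- w\<^sup>2 * h)" "D \<le> 1"
  shows "K.mom g 0 - K.mom g 1 \<le> 2 * exp (- (real d * D\<^sup>2 / 8))"
proof -
  let ?K = "\<lambda>x y. sqrt ((dens x * prop1 h x y) * (dens y * prop1 h y x))"
  let ?S = "\<lambda>x y. sqrt ((pd x * qd x y) * (pd y * qd y x))"
  have D1: "1 - D\<^sup>2 / 8 \<ge> 0" using D power_le_one[of D 2] by simp
  have prod: "?S x y = (\<Prod>i<d. ?K (x i) (y i))" for x y
  proof -
    have "sqrt (\<Prod>i<n. f i) = (\<Prod>i<n. sqrt (f i))" for f :: "nat \<Rightarrow> real" and n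
      by (induction n) (auto simp: real_sqrt_mult)
    then show ?thesis unfolding pd_def qd_def prod.distrib[symmetric] .
  qed
  have [measurable]: "(\<lambda>z. ?S (fst z) (snd z)) \<in> borel_measurable (lebd d \<Otimes>\<^sub>M lebd d)"
    by measurable
  then have [measurable]: "(\<lambda>(x, y). ?S x y) \<in> borel_measurable (lebd d \<Otimes>\<^sub>M lebd d)"
    by (simp only: case_prod_unfold)
  have "K.mom g 0 - K.mom g 1 \<le> 2 * (1 - D\<^sup>2 / 8) ^ d"
  proof (rule gap_le[where F="\<lambda>x y. 2 * ?S x y"])
    fix x y
    have "\<bar>g x - g y\<bar> \<le> 2" unfolding g_def
      using abs_sin_le_one[of "sqrt a * x 0"] abs_sin_le_one[of "sqrt a * y 0"] by linarith
    then have "(g x - g y)\<^sup>2 \<le> 4" using power_mono[of "\<bar>g x - g y\<bar>" 2 2] by simp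
    then have "pd x * kd x y * ((g x - g y)\<^sup>2 / 2) \<le> pd x * kd x y * 2"
      using pd_pos[of x] kd_nonneg[of x y] by (intro mult_left_mono) auto
    moreover have "pd x * kd x y \<le> ?S x y"
    proof (rule real_le_rsqrt)
      let ?u = "pd x * qd x y" and ?v = "pd y * qd y x"
      have nn: "?u \<ge> 0" "?v \<ge> 0" using pd_pos qd_pos by (auto simp: less_imp_le)
      show "(pd x * kd x y)\<^sup>2 \<le> ?u * ?v"
        unfolding balance_min power2_eq_square using nn by (intro mult_mono) auto
    qed
    ultimately show "pd x * kd x y * ((g x - g y)\<^sup>2 / 2) \<le> 2 * ?S x y" by linarith
  next
    have Knn: "?K x y \<ge> 0" for x y by (simp add: dens_nonneg prop1_nonneg)
    have "(\<integral>\<^sup>+x. \<integral>\<^sup>+y. ennreal (2 * ?S x y) \<partial>lebd d \<partial>lebd d)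
      = (\<integral>\<^sup>+x. ennreal 2 * (\<integral>\<^sup>+y. ennreal (?S x y) \<partial>lebd d) \<partial>lebd d)"
    proof (rule nn_integral_cong)
      fix x assume "x \<in> space (lebd d)"
      then have [measurable]: "?S x \<in> borel_measurable (lebd d)" by measurable
      have "(\<integral>\<^sup>+y. ennreal (2 * ?S x y) \<partial>lebd d) = (\<integral>\<^sup>+y. ennreal 2 * ennreal (?S x y) \<partial>lebd d)"
        by (intro nn_integral_cong ennreal_mult') simp
      also have "\<dots> = ennreal 2 * (\<integral>\<^sup>+y. ennreal (?S x y) \<partial>lebd d)"
        by (rule nn_integral_cmult) measurable
      finally show "(\<integral>\<^sup>+y. ennreal (2 * ?S x y) \<partial>lebd d) = ennreal 2 * (\<integral>\<^sup>+y. ennreal (?S x y) \<partial>lebd d)" .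
    qed
    also have "\<dots> = ennreal 2 * (\<integral>\<^sup>+x. \<integral>\<^sup>+y. ennreal (?S x y) \<partial>lebd d \<partial>lebd d)"
      by (rule nn_integral_cmult) measurable
    finally have two: "(\<integral>\<^sup>+x. \<integral>\<^sup>+y. ennreal (2 * ?S x y) \<partial>lebd d \<partial>lebd d)
      = ennreal 2 * (\<integral>\<^sup>+x. \<integral>\<^sup>+y. ennreal (?S x y) \<partial>lebd d \<partial>lebd d)" .
    have "(\<integral>\<^sup>+x. \<integral>\<^sup>+y. ennreal (?S x y) \<partial>lebd d \<partial>lebd d)
      = (\<Prod>i<d. \<integral>\<^sup>+x. \<integral>\<^sup>+y. ennreal (?K x y) \<partial>lborel \<partial>lborel)"
      unfolding prod by (rule nn_integral_lebd_prod2[of d "\<lambda>_. ?K"]) (measurable, rule Knn)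
    also have "\<dots> \<le> (\<Prod>i<d. ennreal (1 - D\<^sup>2 / 8))"
      by (intro prod_mono_ennreal affinity_le[OF h_pos D(1,2)])
    also have "\<dots> = ennreal ((1 - D\<^sup>2 / 8) ^ d)" using D1 by (simp add: ennreal_power)
    finally have "ennreal 2 * (\<integral>\<^sup>+x. \<integral>\<^sup>+y. ennreal (?S x y) \<partial>lebd d \<partial>lebd d) \<le> ennreal 2 * ennreal ((1 - D\<^sup>2 / 8) ^ d)"
      by (rule mult_left_mono) simp
    then show "(\<integral>\<^sup>+x. \<integral>\<^sup>+y. ennreal (2 * ?S x y) \<partial>lebd d \<partial>lebd d) \<le> ennreal (2 * (1 - D\<^sup>2 / 8) ^ d)"
      unfolding two using D1 by (subst ennreal_mult) auto
    show "0 \<le> 2 * (1 - D\<^sup>2 / 8) ^ d" using D1 by simp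
  qed
  also have "\<dots> \<le> 2 * exp (- (D\<^sup>2 / 8)) ^ d"
    using D1 exp_ge_add_one_self[of "- (D\<^sup>2 / 8)"] by (intro mult_left_mono power_mono) auto
  also have "exp (- (D\<^sup>2 / 8)) ^ d = exp (- (real d * D\<^sup>2 / 8))"
    by (simp flip: exp_of_nat_mult)
  finally show ?thesis .
qed

end
section \<open>The minimax lower bound\<close>

lemma exp_minus_le: "exp (- s) \<le> 1 - s / 2" if "0 \<le> s" "s \<le> 1" for s :: real
proof -
  have "s * s \<le> s * 1" using that by (intro mult_left_mono) auto
  then have "1 \<le> (1 + s) * (1 - s / 2)" by (simp add: algebra_simps)
  also have "\<dots> \<le> exp s * (1 - s / 2)" using that by (intro mult_right_mono exp_ge_add_one_self) auto
  finally show ?thesis by (simp add: exp_minus field_simps)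
qed

text \<open>The target may depend on \<open>h\<close>, since the minimum over step sizes is
  outermost. For small \<open>h * L\<close> the chain moves too little in a target of curvature
  \<open>m\<close>; for \<open>h * L\<close> at least 1 it rejects too often in a Gaussian of
  curvature \<open>L\<close>; in between the ripple causes the rejections.\<close>

lemma hard_instance:
  fixes L m h Lam :: real and d :: nat
  assumes m: "m > 0" and kappa: "3 \<le> L / m" and h: "h > 0"
    and Lam: "Lam = max (ln (L / m)) (ln (real d))" "1200 * Lam \<le> d" and d: "d \<ge> 3"
    and eta: "eta = 300 * Lam ^ 3 / (L / m * sqrt d)" "eta \<le> 1/16"
    and M: "M \<ge> 12" and eps: "0 < eps"
  shows "\<exists>f \<mu>0. in_class d L m f \<and> warm d M f \<mu>0 \<and>
    ereal (ln ((1/16) / eps) / (32 * eta)) \<le> ereal_of_enat (tau_tv d f h eps \<mu>0)"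
proof -
  have L: "3 * m \<le> L" "L > 0" using kappa m by (auto simp: field_simps)
  have ln3: "1 \<le> ln (3::real)" using exp_le by (subst ln_ge_iff) auto
  have lnd: "1 \<le> ln (real d)" "ln (real d) \<le> Lam"
  proof -
    have "ln 3 \<le> ln (real d)" using d by (subst ln_le_cancel_iff) auto
    then show "1 \<le> ln (real d)" using ln3 by linarith
    show "ln (real d) \<le> Lam" unfolding Lam(1) by simp
  qed
  have Lam1: "1 \<le> Lam" using lnd by simp
  have sd: "sqrt d \<ge> 1" using d by simp
  have kd: "L / m * sqrt d > 0" using kappa sd by (intro mult_pos_pos) auto
  have eta0: "eta > 0" unfolding eta(1) using Lam1 kd by (intro divide_pos_pos) auto
  \<comment> \<open>All regimes end alike once the Dirichlet form is at most \<open>eta\<close>. The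
    locale constants carry explicit parameters because each regime has its own instance.\<close>
  have reduce: ?thesis
    if rip: "mala_ripple a dl d h" and cls: "m \<le> a - dl * w\<^sup>2" "a + dl * w\<^sup>2 \<le> L" and dl: "dl \<le> 1/3"
      and gap: "reversible_kernel.mom (lebd d) (mala_ripple.pd a dl w d) (mala_ripple.kd a dl w d h) (mala_ripple.g a) 0
        - reversible_kernel.mom (lebd d) (mala_ripple.pd a dl w d) (mala_ripple.kd a dl w d h) (mala_ripple.g a) 1 \<le> eta"
    for a dl w
  proof -
    interpret R: mala_ripple a dl w d h by (rule rip)
    show ?thesis
      using R.fd_in_class[OF cls] R.warm_start[of M] R.tau_lower[OF dl eta0 eta(2) gap eps] M by auto
  qed
  \<comment> \<open>The logarithm of \<open>L / m * sqrt d\<close> is a full ln (L / m) plus half of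
    ln d, hence at most 3/2 Lam.\<close>
  have small: "2 * exp (- x) \<le> eta" if "3/2 * Lam \<le> x" for x
  proof -
    have "L / m * sqrt d = exp (ln (L / m) + ln (real d) / 2)"
      using kappa d by (simp add: exp_add ln_sqrt[symmetric])
    also have "\<dots> \<le> exp x" using that unfolding Lam(1) by (subst exp_le_cancel_iff) linarith
    finally have "exp (- x) * (L / m * sqrt d) \<le> exp (- x) * exp x" by (intro mult_left_mono) auto
    then have "exp (- x) * (L / m * sqrt d) \<le> 1" by (simp flip: exp_add)
    moreover have "1 \<le> Lam ^ 3" using Lam1 by simp
    ultimately have "2 * exp (- x) * (L / m * sqrt d) \<le> 300 * Lam ^ 3" by linarith
    then show ?thesis unfolding eta(1) by (subst pos_le_divide_eq[OF kd])
  qed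
  consider "h * L \<le> 200 * Lam ^ 3 / sqrt d" | "1 \<le> h * L" | "200 * Lam ^ 3 / sqrt d < h * L" "h * L < 1"
    by linarith
  then show ?thesis
  proof cases
    case 1
    \<comment> \<open>No ripple and the least curvature allowed. The threshold constant 200 times
      3/2 gives the 300 in \<open>eta\<close>.\<close>
    interpret R: mala_ripple m 0 0 d h using m h d by unfold_locales auto
    have "3/2 * (m * h) = 3/2 * (h * L) / (L / m)" using m L by simp
    also have "\<dots> \<le> 3/2 * (200 * Lam ^ 3 / sqrt d) / (L / m)" using 1 kappa by (intro divide_right_mono mult_left_mono) auto
    also have "\<dots> = eta" unfolding eta(1) by simp
    finally show ?thesis
      using R.gap_gaussian L m by (intro reduce[OF R.mala_ripple_axioms, where w=0]) auto
  next
    case 2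
    \<comment> \<open>At this frequency the noise factor is exp (-1) \<le> 2/5, while the stationary
      mean is at least 1/2 because h L \<ge> 1; this leaves D = 1/10.\<close>
    define w where "w = 1 / sqrt h"
    interpret R: mala_ripple L 0 w d h using L h d by unfold_locales auto
    have w2: "w\<^sup>2 = 1 / h" using h unfolding w_def by (simp add: power_divide)
    have "1 / (h * (2 * L)) \<le> 1 / 2" using 2 h L by (simp add: field_simps)
    then have "1 - 1/2 \<le> exp (- w\<^sup>2 / (2 * L))"
      using exp_ge_add_one_self[of "- w\<^sup>2 / (2 * L)"] by (simp add: w2)
    moreover have "exp (- w\<^sup>2 * h) \<le> 2/5"
    proof -
      have "exp (1::real) \<ge> 1 + 1 + 1\<^sup>2 / 2" by (rule exp_lower_Taylor_quadratic) simp
      then show ?thesis using h by (simp add: w2 exp_minus field_simps)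
    qed
    ultimately have "1/10 \<le> exp (- w\<^sup>2 / (2 * L)) - exp (- w\<^sup>2 * h)" by linarith
    then have "R.K.mom R.g 0 - R.K.mom R.g 1 \<le> 2 * exp (- (real d * (1/10)\<^sup>2 / 8))"
      by (intro R.gap_affinity) auto
    \<comment> \<open>The exponent is d / 800, and 1200 Lam \<le> d says that it is at least 3/2
      Lam.\<close>
    also have "\<dots> \<le> eta" by (rule small) (use Lam(2) in \<open>simp add: power2_eq_square\<close>)
    finally show ?thesis
      using L m by (intro reduce[OF R.mala_ripple_axioms, where w=w]) auto
  next
    case 3
    \<comment> \<open>The frequency makes \<open>exp (- w\<^sup>2 h) = 1 / d\<close>; the amplitude makes the curvature of the ripple \<open>dl w\<^sup>2 = L / 3\<close>.\<close>
    define t s where "t = h * L" and "s = ln (real d)"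
    define w dl D where "w = sqrt (s / h)" and "dl = t / (3 * s)" and "D = t / (48 * s)"
    have t: "0 < t" "t < 1" "200 * Lam ^ 3 \<le> t * sqrt d"
      using 3 h L sd unfolding t_def by (auto simp: field_simps)
    have s: "1 \<le> s" "s \<le> Lam" using lnd unfolding s_def by auto
    have dl: "0 < dl" "dl \<le> 1/3" using t s unfolding dl_def by (auto simp: field_simps)
    \<comment> \<open>Mean curvature 2 L / 3 with a ripple of L / 3 keeps the second derivative in
      [L / 3, L]; here L / m \<ge> 3 gives m \<le> L / 3.\<close>
    interpret R: mala_ripple "2 * L / 3" dl w d h using L h d dl by unfold_locales auto
    have w2: "w\<^sup>2 = s / h" using h s unfolding w_def by simp
    have dw: "dl * w\<^sup>2 = L / 3" using h s unfolding w2 dl_def t_def by simp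
    have "- w\<^sup>2 * h = - s" using h by (simp add: w2)
    then have "exp (- w\<^sup>2 * h) = 1 / d" using d unfolding s_def by (simp add: exp_minus divide_inverse)
    \<comment> \<open>\<open>D\<close> is \<open>dl / 16\<close>. The stationary mean is at least
      twice \<open>D\<close>, and one \<open>D\<close> is spent on the noise factor 1 / d; the lower
      end of the regime makes \<open>t * d\<close> large enough for that.\<close>
    also have "\<dots> \<le> D"
    proof -
      have "48 * s \<le> 200 * Lam ^ 3" using s self_le_power[of Lam 3] Lam1 by linarith
      also have "\<dots> \<le> t * d"
      proof -
        have "t * sqrt d * 1 \<le> t * sqrt d * sqrt d" using t sd by (intro mult_left_mono) auto
        then show ?thesis using t(3) by (simp add: mult.assoc)
      qed
      finally show ?thesis unfolding D_def using s d by (simp add: field_simps)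
    qed
    finally have e1: "exp (- w\<^sup>2 * h) \<le> D" .
    have "2 * D \<le> exp (- dl) * (exp (- w\<^sup>2 / (2 * (2 * L / 3))) + (1 - exp (- dl)) / 2)"
    proof -
      have "1/2 * (dl / 4) \<le> exp (- dl) * (exp (- w\<^sup>2 / (2 * (2 * L / 3))) + (1 - exp (- dl)) / 2)"
      proof (rule mult_mono)
        show "1/2 \<le> exp (- dl)" using exp_ge_add_one_self[of "- dl"] dl by linarith
        have "exp (- dl) \<le> 1 - dl / 2" by (rule exp_minus_le) (use dl in auto)
        then have "dl / 4 \<le> (1 - exp (- dl)) / 2" by simp
        then show "dl / 4 \<le> exp (- w\<^sup>2 / (2 * (2 * L / 3))) + (1 - exp (- dl)) / 2"
          by (rule add_increasing[OF exp_ge_zero])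
      qed (use dl in auto)
      then show ?thesis unfolding D_def dl_def by simp
    qed
    then have e2: "D \<le> exp (- dl) * (exp (- w\<^sup>2 / (2 * (2 * L / 3))) + (1 - exp (- dl)) / 2) - exp (- w\<^sup>2 * h)"
      using e1 by linarith
    have D: "0 \<le> D" "D \<le> 1" using t s unfolding D_def by (auto simp: field_simps)
    \<comment> \<open>18432 is 8 times 48 squared. The regime gives t^2 d \<ge> 40000 Lam^6, more
      than the required 27648 Lam^3.\<close>
    have "3/2 * Lam \<le> real d * D\<^sup>2 / 8"
    proof -
      have "(200 * Lam ^ 3)\<^sup>2 \<le> (t * sqrt d)\<^sup>2" using t(3) Lam1 by (intro power_mono) auto
      then have td: "40000 * Lam ^ 6 \<le> t\<^sup>2 * d" by (simp add: power_mult_distrib flip: power_mult)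
      have "Lam * (18432 * s\<^sup>2) * (3/2) \<le> Lam * (18432 * Lam\<^sup>2) * (3/2)"
        using s Lam1 by (intro mult_left_mono mult_right_mono power_mono) auto
      also have "\<dots> = 27648 * Lam ^ 3" by (simp add: power2_eq_square power3_eq_cube)
      also have "\<dots> \<le> 40000 * Lam ^ 6" using Lam1 by (intro mult_mono power_increasing) auto
      also note td
      finally have "3/2 * Lam \<le> t\<^sup>2 * d / (18432 * s\<^sup>2)" using s by (simp add: field_simps)
      also have "\<dots> = real d * D\<^sup>2 / 8" unfolding D_def by (simp add: power_divide power_mult_distrib)
      finally show ?thesis .
    qed
    then have "R.K.mom R.g 0 - R.K.mom R.g 1 \<le> eta"
      using R.gap_affinity[OF D(1) e2 D(2)] small by (meson order_trans)
    then show ?thesis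
      using L m dl by (intro reduce[OF R.mala_ripple_axioms, where w=w]) (auto simp: dw)
  qed
qed

text \<open>Polynomial growth of \<kappa> bounds both logarithms by a constant plus a multiple of ln
  d, and a fixed power of that is eventually below sqrt d.\<close>

lemma polylog_small:
  fixes \<alpha> \<beta> :: real
  assumes "\<alpha> > 0" "\<beta> > 0"
  shows "\<exists>N::nat. N > 0 \<and> (\<forall>d>N. d \<ge> 3 \<and> (\<forall>\<kappa>. 3 \<le> \<kappa> \<longrightarrow> \<kappa> \<le> \<alpha> * real d powr \<beta> \<longrightarrow>
    1200 * max (ln \<kappa>) (ln (real d)) \<le> d \<and> 300 * max (ln \<kappa>) (ln (real d)) ^ 3 / (\<kappa> * sqrt d) \<le> 1/16))"
proof -
  \<comment> \<open>\<open>\<beta> + 1\<close> rather than \<open>\<beta>\<close>, so that the bound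
    dominates ln d as well as ln \<kappa>.\<close>
  define A B where "A = \<bar>ln \<alpha>\<bar>" and "B = \<beta> + 1"
  have B: "B > 0" using assms unfolding B_def by simp
  have "eventually (\<lambda>d::nat. 1200 * (A + B * ln (real d)) \<le> d) at_top" using B by real_asymp
  moreover have "eventually (\<lambda>d::nat. 1600 * (A + B * ln (real d)) ^ 3 \<le> sqrt d) at_top" using B by real_asymp
  ultimately have "eventually (\<lambda>d::nat. d \<ge> 3 \<and> 1200 * (A + B * ln (real d)) \<le> d \<and> 1600 * (A + B * ln (real d)) ^ 3 \<le> sqrt d) at_top"
    using eventually_ge_at_top[of "3::nat"] by eventually_elim auto
  then obtain N where N: "\<And>d. d \<ge> N \<Longrightarrow> d \<ge> 3 \<and> 1200 * (A + B * ln (real d)) \<le> d \<and> 1600 * (A + B * ln (real d)) ^ 3 \<le> sqrt d"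
    unfolding eventually_at_top_linorder by auto
  show ?thesis
  proof (intro exI[of _ "Suc N"] conjI allI impI)
    fix d assume "Suc N < d"
    then have d: "d \<ge> 3" "1200 * (A + B * ln (real d)) \<le> d" "1600 * (A + B * ln (real d)) ^ 3 \<le> sqrt d" using N[of d] by auto
    then show "3 \<le> d" by simp
    fix \<kappa> :: real assume k: "3 \<le> \<kappa>" "\<kappa> \<le> \<alpha> * real d powr \<beta>"
    let ?m = "max (ln \<kappa>) (ln (real d))"
    have l: "ln (real d) \<ge> 0" using d by simp
    have "ln \<kappa> \<le> ln (\<alpha> * real d powr \<beta>)" using k by (intro ln_mono) auto
    also have "\<dots> = ln \<alpha> + \<beta> * ln (real d)" using assms d by (simp add: ln_mult ln_powr)
    also have "\<dots> \<le> A + B * ln (real d)" unfolding A_def B_def using l by (simp add: algebra_simps)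
    finally have 1: "ln \<kappa> \<le> A + B * ln (real d)" .
    have "1 * ln (real d) \<le> B * ln (real d)" using l assms unfolding B_def by (intro mult_right_mono) auto
    then have m: "0 \<le> ?m" "?m \<le> A + B * ln (real d)" using 1 l unfolding A_def by auto
    show "1200 * ?m \<le> d" by (rule order_trans[OF mult_left_mono[OF m(2)] d(2)]) simp
    have "?m ^ 3 \<le> (A + B * ln (real d)) ^ 3" using m by (intro power_mono) auto
    \<comment> \<open>4800 is 16 times 300, and 3 is the least value of \<kappa>; hence the 1600
      asked of \<open>N\<close>.\<close>
    then have "4800 * ?m ^ 3 \<le> 3 * sqrt d" using d(3) by linarith
    also have "\<dots> \<le> \<kappa> * sqrt d" using k by (intro mult_right_mono) auto
    finally show "300 * ?m ^ 3 / (\<kappa> * sqrt d) \<le> 1/16"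
      using k d by (simp add: field_simps)
  qed simp
qed

theorem theorem2:
  shows "\<exists>c3>0. \<exists>c4>0. \<forall>\<alpha>>0. \<forall>\<beta>>0. \<exists>N::nat. N > 0 \<and>
    (\<forall>d>N. \<forall>L m \<epsilon> M::real.
       L > 0 \<longrightarrow> m > 0 \<longrightarrow> 3 \<le> L / m \<longrightarrow> L / m \<le> \<alpha> * real d powr \<beta> \<longrightarrow>
       M \<ge> 12 \<longrightarrow> 0 < \<epsilon> \<longrightarrow> \<epsilon> < 1 \<longrightarrow>
       ereal (c3 * (L / m) * sqrt (real d) / (max (ln (L / m)) (ln (real d))) ^ 3 * ln (c4 / \<epsilon>))
         \<le> ereal_of_enat (mixing_time d L m \<epsilon> M))"
proof (rule exI[of _ "1/9600"], rule conjI, simp, rule exI[of _ "1/16"], rule conjI, simp, intro allI impI)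
  fix \<alpha> \<beta> :: real assume "\<alpha> > 0" "\<beta> > 0"
  from polylog_small[OF this] obtain N :: nat where "N > 0"
    and N: "\<And>d \<kappa>. d > N \<Longrightarrow> d \<ge> 3 \<and> (3 \<le> \<kappa> \<longrightarrow> \<kappa> \<le> \<alpha> * real d powr \<beta> \<longrightarrow>
      1200 * max (ln \<kappa>) (ln (real d)) \<le> d \<and> 300 * max (ln \<kappa>) (ln (real d)) ^ 3 / (\<kappa> * sqrt d) \<le> 1/16)"
    by blast
  have "ereal (1/9600 * (L / m) * sqrt (real d) / (max (ln (L / m)) (ln (real d))) ^ 3 * ln ((1/16) / eps))
         \<le> ereal_of_enat (mixing_time d L m eps M)"
    if d: "d > N" and m: "m > 0" and k: "3 \<le> L / m" "L / m \<le> \<alpha> * real d powr \<beta>"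
      and M: "M \<ge> 12" and eps: "0 < eps" for d L m eps M
  proof -
    let ?Lam = "max (ln (L / m)) (ln (real d))"
    define eta where "eta = 300 * ?Lam ^ 3 / (L / m * sqrt d)"
    define R where "R = ln ((1/16) / eps) / (32 * eta)"
    \<comment> \<open>Rounding up first keeps the infimum and the suprema inside
      \<open>enat\<close>, infinite mixing times included.\<close>
    define n where "n = nat \<lceil>R\<rceil>"
    have "enat n \<le> mixing_time d L m eps M"
      unfolding mixing_time_def
    proof (rule INF_greatest)
      fix h :: real assume "h \<in> {h. h > 0}"
      then have h: "h > 0" by simp
      have "\<exists>f \<mu>0. in_class d L m f \<and> warm d M f \<mu>0 \<and> ereal R \<le> ereal_of_enat (tau_tv d f h eps \<mu>0)"
        unfolding R_def using N[OF d, of "L / m"] k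
        by (intro hard_instance[OF m k(1) h refl _ _ eta_def _ M eps]) (auto simp: eta_def)
      then obtain f \<mu>0 where f: "in_class d L m f" "warm d M f \<mu>0" and R: "ereal R \<le> ereal_of_enat (tau_tv d f h eps \<mu>0)"
        by blast
      have "enat n \<le> tau_tv d f h eps \<mu>0"
      proof (cases "tau_tv d f h eps \<mu>0")
        case (enat j)
        then have "R \<le> real j" using R by simp
        then have "n \<le> j" unfolding n_def by linarith
        then show ?thesis using enat by simp
      qed simp
      also have "\<dots> \<le> (SUP \<mu>0\<in>{\<mu>0. warm d M f \<mu>0}. tau_tv d f h eps \<mu>0)" using f(2) by (intro SUP_upper) simp
      also have "\<dots> \<le> (SUP f\<in>{f. in_class d L m f}. SUP \<mu>0\<in>{\<mu>0. warm d M f \<mu>0}. tau_tv d f h eps \<mu>0)"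
        using f(1) by (intro SUP_upper) simp
      finally show "enat n \<le> (SUP f\<in>{f. in_class d L m f}. SUP \<mu>0\<in>{\<mu>0. warm d M f \<mu>0}. tau_tv d f h eps \<mu>0)" .
    qed
    then have "ereal_of_enat (enat n) \<le> ereal_of_enat (mixing_time d L m eps M)"
      by (simp only: ereal_of_enat_le_iff)
    moreover have "ereal R \<le> ereal_of_enat (enat n)" unfolding n_def by (simp, linarith)
    \<comment> \<open>9600 is 32 from the bound on a single mixing time, times the 300 in
      \<open>eta\<close>.\<close>
    moreover have "1/9600 * (L / m) * sqrt (real d) / ?Lam ^ 3 * ln ((1/16) / eps) = R"
      unfolding R_def eta_def by (simp add: mult_ac)
    ultimately show ?thesis by (metis order_trans)
  qed
  then show "\<exists>N::nat. N > 0 \<and>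
    (\<forall>d>N. \<forall>L m \<epsilon> M::real.
       L > 0 \<longrightarrow> m > 0 \<longrightarrow> 3 \<le> L / m \<longrightarrow> L / m \<le> \<alpha> * real d powr \<beta> \<longrightarrow>
       M \<ge> 12 \<longrightarrow> 0 < \<epsilon> \<longrightarrow> \<epsilon> < 1 \<longrightarrow>
       ereal (1/9600 * (L / m) * sqrt (real d) / (max (ln (L / m)) (ln (real d))) ^ 3 * ln (1/16 / \<epsilon>))
         \<le> ereal_of_enat (mixing_time d L m \<epsilon> M))"
    using \<open>N > 0\<close> by blast
qed

end
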